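(* Let $\Omega$ be a simply connected domain containing $\mathbb{D}$ and let $\lambda=\lambda(\Omega)$ (assumed finite and positive). If $f\in\mathcal{B}(\Omega)$ with $f(z)=\sum_{n=0}^\infty a_nz^n$ for $z\in\mathbb{D}$, then $$\sum_{n=0}^\infty|a_n|r^n+\left(\frac{1+\lambda}{2\lambda(1+|a_0|)}+\frac{2}{3}\,\frac{(1+\lambda)r}{1-r}\right)\sum_{n=1}^\infty|a_n|^2r^{2n}\le1\quad\text{for } 0<r\le\frac{1}{1+2\lambda}.$$ Equality at $r=1/(1+2\lambda)$ can only occur when $f$ is a unimodular constant.
   Context: $\mathbb{D}$ is the open unit disk; $\mathcal{B}(\Omega)$ is the class of analytic $f$ on $\Omega$ with $|f|<1$ on $\Omega$. $\lambda(\Omega)=\sup\{|a_n|/(1-|a_0|^2): n\ge1,\ f\in\mathcal{B}(\Omega)\text{ nonconstant},\ f(z)=\sum a_nz^n \text{ on }\mathbb{D}\}$, so that $|a_n|\le\lambda(1-|a_0|^2)$ for all $n\ge1$ and all $f\in\mathcal{B}(\Omega)$. *)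

theory Defs
  imports "HOL-Complex_Analysis.Complex_Analysis"
begin

definition schur_class :: "complex set \<Rightarrow> (complex \<Rightarrow> complex) set" where
  "schur_class \<Omega> = {f. f holomorphic_on \<Omega> \<and> (\<forall>z\<in>\<Omega>. norm (f z) < 1)}"

definition taylor_coeff :: "(complex \<Rightarrow> complex) \<Rightarrow> nat \<Rightarrow> complex" where
  "taylor_coeff f n = (deriv ^^ n) f 0 / fact n"

definition bohr_lambda_set :: "complex set \<Rightarrow> real set" where
  "bohr_lambda_set \<Omega> = {norm (taylor_coeff f n) / (1 - (norm (taylor_coeff f 0))\<^sup>2) | f n.
      n \<ge> 1 \<and> f \<in> schur_class \<Omega> \<and> \<not> (\<exists>c. \<forall>z\<in>\<Omega>. f z = c)}"

definition bohr_lambda :: "complex set \<Rightarrow> real" where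
  "bohr_lambda \<Omega> = Sup (bohr_lambda_set \<Omega>)"

end

theory Submission
  imports Defs
begin

text \<open>
  Write \<open>L = \<lambda> (1 - |a\<^sub>0|\<^sup>2)\<close> and \<open>h = f - a\<^sub>0\<close>. All terms increase with \<open>r\<close>, so it suffices to
  prove a strict inequality at \<open>r = 1 / (1 + 2 \<lambda>)\<close>, where \<open>r / (1 - r) = 1 / (2 \<lambda>)\<close>; a function in the
  class has \<open>|a\<^sub>0| < 1\<close>, so equality never occurs. The bound \<open>|a\<^sub>n| \<le> L\<close> alone is too weak when
  \<open>|a\<^sub>0|\<close> is close to 1; it is improved in two ways.

  If \<open>\<lambda> \<ge> 1/5\<close>: composing \<open>f\<close> with the disc automorphisms \<open>w \<mapsto> (w + cnj t) / (1 + t w)\<close> gives an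
  analytic family in \<open>t\<close> of coefficients bounded by \<open>L\<close>, and the Schwarz--Pick inequality at
  \<open>t = 0\<close> yields \<open>|a\<^sub>n| + |(h\<^sup>2)\<^sub>n| / 2 \<le> L\<close>. By Parseval,
  \<open>\<Sum> |a\<^sub>n|\<^sup>2 r\<^bsup>2n\<^esup> \<le> max |h|\<^sup>2 \<le> \<Sum> |(h\<^sup>2)\<^sub>n| r\<^sup>n\<close>, and the gain suffices.

  If \<open>\<lambda> < 1/5\<close>: the Riemann map of \<open>\<Omega>\<close> has derivative at most \<open>\<lambda>\<close> at 0, so by the Koebe quarter
  theorem \<open>\<Omega>\<close> contains the disc of radius \<open>1 / (4 \<lambda>) > 1\<close>, and \<open>|a\<^sub>n| \<le> (1 - |a\<^sub>0|\<^sup>2) (4 \<lambda>)\<^sup>n\<close>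
  decays geometrically.
\<close>

section \<open>Taylor coefficients of bounded functions\<close>

lemma taylor_coeff_eq_fps_nth:
  "f has_fps_expansion F \<Longrightarrow> taylor_coeff f n = fps_nth F n"
  by (simp add: taylor_coeff_def fps_nth_fps_expansion)

lemma taylor_coeff_0 [simp]: "taylor_coeff f 0 = f 0"
  by (simp add: taylor_coeff_def)

lemma taylor_coeff_expansion:
  assumes "f holomorphic_on ball 0 R" "R > 0"
  shows "f has_fps_expansion Abs_fps (taylor_coeff f)"
proof -
  have "f has_fps_expansion fps_expansion f 0"
    using assms by (intro has_fps_expansion_fps_expansion[of "ball 0 R"]) auto
  also have "fps_expansion f 0 = Abs_fps (taylor_coeff f)"
    by (simp add: fps_expansion_def fps_eq_iff taylor_coeff_def)
  finally show ?thesis .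
qed

lemma taylor_coeff_sums:
  assumes "f holomorphic_on ball 0 R" "norm z < R"
  shows "(\<lambda>n. taylor_coeff f n * z ^ n) sums f z"
  using holomorphic_power_series[OF assms(1), of z] assms(2) by (simp add: taylor_coeff_def)

lemma taylor_coeff_abs_summable:
  assumes "f holomorphic_on ball 0 R" "0 \<le> r" "r < R"
  shows "summable (\<lambda>n. norm (taylor_coeff f n) * r ^ n)"
proof -
  define K where "K = (r + R) / 2"
  have K: "r < K" "K < R" "K \<ge> 0" using assms by (auto simp: K_def)
  have "summable (\<lambda>n. taylor_coeff f n * complex_of_real K ^ n)"
    using taylor_coeff_sums[OF assms(1), of "of_real K"] K by (auto simp: sums_iff)
  then have "summable (\<lambda>n. norm (taylor_coeff f n * complex_of_real r ^ n))"
    by (rule powser_insidea) (use K assms in auto)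
  then show ?thesis using assms by (simp add: norm_mult norm_power)
qed

lemma taylor_coeff_const_mult:
  assumes "f holomorphic_on ball 0 R" "R > 0"
  shows "taylor_coeff (\<lambda>z. c * f z) n = c * taylor_coeff f n"
  by (subst taylor_coeff_eq_fps_nth[OF has_fps_expansion_cmult_left[OF taylor_coeff_expansion[OF assms]]]) simp

lemma taylor_coeff_const [simp]: "taylor_coeff (\<lambda>z. c) n = (if n = 0 then c else 0)"
  by (subst taylor_coeff_eq_fps_nth[OF has_fps_expansion_const]) (auto simp: fps_const_def)

lemma taylor_coeff_cong:
  assumes "open S" "0 \<in> S" "\<And>z. z \<in> S \<Longrightarrow> f z = g z"
  shows "taylor_coeff f n = taylor_coeff g n"
proof -
  have "(deriv ^^ n) f 0 = (deriv ^^ n) g 0"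
    by (rule higher_deriv_cong_ev)
      (use assms in \<open>auto simp: eventually_nhds\<close>)
  then show ?thesis by (simp add: taylor_coeff_def)
qed

lemma taylor_coeff_diff_const:
  assumes "f holomorphic_on ball 0 R" "R > 0" "n \<ge> 1"
  shows "taylor_coeff (\<lambda>z. f z - c) n = taylor_coeff f n"
  by (subst taylor_coeff_eq_fps_nth[OF has_fps_expansion_diff[OF taylor_coeff_expansion[OF assms(1,2)] has_fps_expansion_const]])
     (use assms(3) in simp)

text \<open>Cauchy's inequality on circles of radius \<open>s < R\<close>, followed by letting
  \<open>s\<close> tend to \<open>R\<close>, because \<open>f\<close> is controlled only on the open
  disc.\<close>

lemma taylor_coeff_bounded:
  assumes "f holomorphic_on ball 0 R" "R > 0" "\<And>z. norm z < R \<Longrightarrow> norm (f z) \<le> M"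
  shows "norm (taylor_coeff f n) * R ^ n \<le> M"
proof -
  have *: "norm (taylor_coeff f n) * s ^ n \<le> M" if "0 < s" "s < R" for s
  proof -
    have "norm ((deriv ^^ n) f 0) \<le> fact n * M / s ^ n"
    proof (rule Cauchy_inequality)
      show "f holomorphic_on ball 0 s" 
        using assms(1) that by (meson holomorphic_on_subset less_imp_le subset_ball)
      show "continuous_on (cball 0 s) f"
        by (rule holomorphic_on_imp_continuous_on[OF holomorphic_on_subset[OF assms(1)]]) (use that in auto)
      show "\<And>x. norm (0 - x) = s \<Longrightarrow> norm (f x) \<le> M"
        using assms(3) that by auto
    qed (use that in auto)
    then show ?thesis using that
      by (simp add: taylor_coeff_def norm_divide field_simps)
  qed
  have "((\<lambda>s. norm (taylor_coeff f n) * s ^ n) \<longlongrightarrow> norm (taylor_coeff f n) * R ^ n) (at_left R)"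
    by (intro tendsto_intros)
  then show ?thesis
  proof (rule tendsto_upperbound)
    have "\<forall>\<^sub>F s in at_left R. s \<in> {0<..<R}"
      using assms(2) eventually_at_left_real by blast
    then show "\<forall>\<^sub>F s in at_left R. norm (taylor_coeff f n) * s ^ n \<le> M"
      by eventually_elim (use * in auto)
  qed auto
qed

section \<open>Disc automorphisms, averages over roots of unity, and the Schwarz--Pick coefficient
  bound\<close>

lemma disc_moebius_norm:
  fixes w t :: complex
  assumes "norm w < 1" "norm t < 1"
  shows "1 + t * w \<noteq> 0" "norm ((w + cnj t) / (1 + t * w)) < 1"
    "1 - norm ((w + cnj t) / (1 + t * w)) ^ 2 = (1 - norm t ^ 2) * (1 - norm w ^ 2) / norm (1 + t * w) ^ 2"
proof -
  have "norm (t * w) < 1" using assms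
    by (metis mult_strict_mono' norm_ge_zero norm_mult mult_1)
  then show nz: "1 + t * w \<noteq> 0"
    by (metis add_eq_0_iff norm_minus_cancel norm_one less_irrefl)
  have "norm (1 + t * w) ^ 2 - norm (w + cnj t) ^ 2 = (1 - norm t ^ 2) * (1 - norm w ^ 2)"
    unfolding cmod_power2 by (simp add: algebra_simps power2_eq_square)
  then show eq: "1 - norm ((w + cnj t) / (1 + t * w)) ^ 2 = (1 - norm t ^ 2) * (1 - norm w ^ 2) / norm (1 + t * w) ^ 2"
    using nz by (simp add: norm_divide power_divide field_simps)
  have "(1 - norm t ^ 2) * (1 - norm w ^ 2) / norm (1 + t * w) ^ 2 > 0"
    using nz assms by (simp add: power_less_one_iff abs_square_less_1)
  with eq have "norm ((w + cnj t) / (1 + t * w)) ^ 2 < 1" by simp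
  then show "norm ((w + cnj t) / (1 + t * w)) < 1" by (simp add: abs_square_less_1)
qed

text \<open>The sum is geometric with ratio \<open>w = cis (2 * pi * j / n)\<close>, an
  \<open>n\<close>-th root of unity that equals 1 exactly when \<open>n\<close> divides
  \<open>j\<close>. It serves both the averaging of \<open>u\<close> below and the discrete Parseval
  identity.\<close>

lemma sum_roots_of_unity_powers:
  fixes n j :: nat
  assumes "n > 0"
  shows "(\<Sum>k<n. (cis (2 * pi * k / n)) ^ j) = (if n dvd j then of_nat n else 0)"
proof -
  define w where "w = cis (2 * pi * j / n)"
  have "(\<Sum>k<n. (cis (2 * pi * k / n)) ^ j) = (\<Sum>k<n. w ^ k)"
    proof (intro sum.cong refl)
    fix k :: nat
    have "cis (2 * pi * k / n) ^ j = cis (real j * (2 * pi * k / n))" by (rule Complex.DeMoivre)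
    also have "real j * (2 * pi * k / n) = real k * (2 * pi * j / n)" by simp
    also have "cis \<dots> = w ^ k" unfolding w_def by (rule Complex.DeMoivre[symmetric])
    finally show "cis (2 * pi * k / n) ^ j = w ^ k" .
  qed
  also have "\<dots> = (if n dvd j then of_nat n else 0)"
  proof (cases "n dvd j")
    case True
    then obtain m where "j = n * m" by auto
    then have "2 * pi * j / n = 2 * pi * real m" using assms by simp
    then have "w = 1" unfolding w_def by (simp only: cis_multiple_2pi Ints_of_nat)
    then show ?thesis using True by simp
  next
    case False
    have "w \<noteq> 1"
    proof
      assume "w = 1"
      then have "cos (2 * pi * j / n) = 1" by (simp add: w_def complex_eq_iff)
      then obtain m :: int where m: "2 * pi * j / n = of_int m * 2 * pi"
        using cos_one_2pi_int by auto
      then have "real j = of_int (m * int n)" using assms by (simp add: field_simps)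
      then have "int j = m * int n" by linarith
      then have "int n dvd int j" by simp
      with False show False by simp
    qed
    moreover have "w ^ n = 1"
    proof -
      have "real n * (2 * pi * j / n) = 2 * pi * real j" using assms by simp
      then show ?thesis unfolding w_def Complex.DeMoivre by (simp only: cis_multiple_2pi Ints_of_nat)
    qed
    ultimately show ?thesis using False by (simp add: sum_gp_strict)
  qed
  finally show ?thesis .
qed

text \<open>
  Averaging \<open>u\<close> over the rotations by \<open>n\<close>-th roots of unity removes the coefficients strictly between
  0 and \<open>n\<close>; a disc automorphism sending \<open>u 0\<close> to 0 then multiplies the \<open>n\<close>-th one by
  \<open>1 / (1 - |u 0|\<^sup>2)\<close>.
\<close>

lemma schur_coeff_bound_strict:
  assumes holo: "u holomorphic_on ball 0 1" and lt1: "\<And>z. norm z < 1 \<Longrightarrow> norm (u z) < 1" and n: "n \<ge> 1"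
  shows "norm (taylor_coeff u n) \<le> 1 - norm (u 0) ^ 2"
proof -
  define v where "v z = (\<Sum>k<n. u (cis (2 * pi * k / n) * z)) / of_nat n" for z
  have rot: "(\<lambda>z. u (cis t * z)) has_fps_expansion Abs_fps (\<lambda>j. cis t ^ j * taylor_coeff u j)" for t
  proof -
    have h: "(\<lambda>z. u (cis t * z)) holomorphic_on ball 0 1"
      by (rule holomorphic_on_compose_gen[OF _ holo, unfolded o_def])
         (auto intro!: holomorphic_intros simp: norm_mult)
    have "taylor_coeff (\<lambda>z. u (cis t * z)) j = cis t ^ j * taylor_coeff u j" for j
      using higher_deriv_compose_linear[OF holo, of "ball 0 1" 0 "cis t" j]
      by (auto simp: taylor_coeff_def norm_mult)
    then have "taylor_coeff (\<lambda>z. u (cis t * z)) = (\<lambda>j. cis t ^ j * taylor_coeff u j)" by blast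
    then show ?thesis using taylor_coeff_expansion[OF h] by simp
  qed
  define V where "V = Abs_fps (\<lambda>j. if n dvd j then taylor_coeff u j else 0)"
  have "v has_fps_expansion (\<Sum>k<n. Abs_fps (\<lambda>j. cis (2 * pi * k / n) ^ j * taylor_coeff u j)) * fps_const (1 / of_nat n)"
    unfolding v_def divide_inverse[of "sum _ _"] inverse_eq_divide
    by (intro has_fps_expansion_cmult_right has_fps_expansion_sum rot)
  also have "(\<Sum>k<n. Abs_fps (\<lambda>j. cis (2 * pi * k / n) ^ j * taylor_coeff u j)) * fps_const (1 / of_nat n) = V"
    using n by (simp add: fps_eq_iff V_def fps_sum_nth sum_distrib_right[symmetric] sum_roots_of_unity_powers)
  finally have V: "v has_fps_expansion V" .
  have hv: "v holomorphic_on ball 0 1"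
    unfolding v_def
    by (intro holomorphic_intros holomorphic_on_compose_gen[OF _ holo, unfolded o_def])
       (use n in \<open>auto intro!: holomorphic_intros simp: norm_mult\<close>)
  have v1: "norm (v z) < 1" if "norm z < 1" for z
  proof -
    have "norm (\<Sum>k<n. u (cis (2 * pi * k / n) * z)) \<le> (\<Sum>k<n. norm (u (cis (2 * pi * k / n) * z)))"
      by (rule norm_sum)
    also have "\<dots> < (\<Sum>k<n. 1)"
      by (intro sum_strict_mono lt1) (use n that in \<open>auto simp: norm_mult lessThan_empty_iff\<close>)
    finally show ?thesis using n by (simp add: v_def norm_divide)
  qed
  define t where "t = - cnj (u 0)"
  have v0: "v 0 = u 0" using n by (simp add: v_def)
  have t1: "norm t < 1" using lt1[of 0] by (simp add: t_def)
  define q where "q z = (v z + cnj t) / (1 + t * v z)" for z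
  have nz: "1 + t * v z \<noteq> 0" if "norm z < 1" for z
    using disc_moebius_norm(1)[OF v1[OF that] t1] .
  have q1: "norm (q z) < 1" if "norm z < 1" for z
    using disc_moebius_norm(2)[OF v1[OF that] t1] by (simp add: q_def)
  have hq: "q holomorphic_on ball 0 1"
    unfolding q_def using nz by (intro holomorphic_intros hv) auto
  define W where "W = inverse (1 + fps_const t * V)"
  have V0: "fps_nth V 0 = u 0" by (simp add: V_def)
  have nz0: "1 + t * u 0 \<noteq> 0" using nz[of 0] v0 by simp
  have "(\<lambda>z. (v z + cnj t) * inverse (1 + t * v z)) has_fps_expansion (V + fps_const (cnj t)) * W"
    unfolding W_def using nz0 V0
    by (intro has_fps_expansion_mult has_fps_expansion_add has_fps_expansion_const
        has_fps_expansion_inverse has_fps_expansion_1 has_fps_expansion_cmult_left V) auto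
  then have "taylor_coeff q n = fps_nth ((V + fps_const (cnj t)) * W) n"
    using taylor_coeff_eq_fps_nth[of q "(V + fps_const (cnj t)) * W" n] unfolding q_def divide_inverse by blast
  also have "\<dots> = (\<Sum>i=0..n. fps_nth (V + fps_const (cnj t)) i * fps_nth W (n - i))"
    by (simp add: fps_mult_nth)
  \<comment> \<open>Only \<open>i = n\<close> survives: the constant term cancels by the choice of
    \<open>t\<close>, and the averaged series \<open>V\<close> has nothing strictly between 0 and
    \<open>n\<close>. So \<open>W\<close> enters only through its constant term
    \<open>1 / (1 + t * u 0)\<close>.\<close>
  also have "\<dots> = (\<Sum>i\<in>{n}. fps_nth (V + fps_const (cnj t)) i * fps_nth W (n - i))"
    using n V0 by (intro sum.mono_neutral_right) (auto simp: V_def t_def dest: dvd_imp_le)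
  also have "\<dots> = taylor_coeff u n / (1 + t * u 0)"
    using n by (simp add: V_def W_def divide_inverse)
  finally have tq: "taylor_coeff q n = taylor_coeff u n / (1 + t * u 0)" .
  have "1 + t * u 0 = of_real (1 - norm (u 0) ^ 2)"
    by (simp add: t_def complex_norm_square[symmetric] mult.commute del: of_real_power)
  moreover have pos: "1 - norm (u 0) ^ 2 > 0"
    using lt1[of 0] by (simp add: abs_square_less_1)
  ultimately have "norm (taylor_coeff q n) = norm (taylor_coeff u n) / (1 - norm (u 0) ^ 2)"
    unfolding tq by (simp add: norm_divide del: of_real_diff of_real_power)
  then have "norm (taylor_coeff u n) = norm (taylor_coeff q n) * (1 - norm (u 0) ^ 2)"
    using pos by simp
  moreover have "norm (taylor_coeff q n) \<le> 1"
    using taylor_coeff_bounded[OF hq, of 1 n] q1 by (auto intro: less_imp_le)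
  ultimately show ?thesis using pos by (simp add: mult_left_le_one_le)
qed

text \<open>The strict version is applied to \<open>s * u\<close> with \<open>s < 1\<close>, then
  \<open>s\<close> tends to 1. The weak hypothesis is the one that the quotient \<open>p / L\<close>
  in \<open>schur_class_coeff_improved\<close> satisfies.\<close>

lemma schur_coeff_bound:
  assumes holo: "u holomorphic_on ball 0 1" and le1: "\<And>z. norm z < 1 \<Longrightarrow> norm (u z) \<le> 1" and n: "n \<ge> 1"
  shows "norm (taylor_coeff u n) \<le> 1 - norm (u 0) ^ 2"
proof -
  have *: "s * norm (taylor_coeff u n) \<le> 1 - (s * norm (u 0)) ^ 2" if "0 < s" "s < 1" for s :: real
  proof -
    have "norm (of_real s * u z) < 1" if "norm z < 1" for z
    proof -
      have "s * norm (u z) \<le> s * 1" using le1[OF that] \<open>0 < s\<close> by (intro mult_left_mono) auto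
      moreover have "norm (of_real s * u z) = s * norm (u z)" using \<open>0 < s\<close> by (simp add: norm_mult)
      ultimately show ?thesis using \<open>s < 1\<close> by linarith
    qed
    then have "norm (taylor_coeff (\<lambda>z. of_real s * u z) n) \<le> 1 - norm (of_real s * u 0) ^ 2"
      by (intro schur_coeff_bound_strict holomorphic_intros holo n) auto
    then show ?thesis using that
      by (simp add: taylor_coeff_const_mult[OF holo] norm_mult)
  qed
  have "((\<lambda>s. 1 - (s * norm (u 0)) ^ 2 - s * norm (taylor_coeff u n)) \<longlongrightarrow> 1 - (1 * norm (u 0)) ^ 2 - 1 * norm (taylor_coeff u n)) (at_left 1)"
    by (intro tendsto_intros)
  then have "0 \<le> 1 - (1 * norm (u 0)) ^ 2 - 1 * norm (taylor_coeff u n)"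
  proof (rule tendsto_lowerbound)
    have "\<forall>\<^sub>F s in at_left (1::real). s \<in> {0<..<1}"
      using eventually_at_left_real[of 0 "1::real"] by simp
    then show "\<forall>\<^sub>F s in at_left 1. 0 \<le> 1 - (s * norm (u 0)) ^ 2 - s * norm (taylor_coeff u n)"
      by eventually_elim (use * in simp)
  qed auto
  then show ?thesis by simp
qed

text \<open>A discrete Parseval argument: for the Taylor polynomial \<open>P\<close> of degree below
  \<open>m\<close>, the mean of \<open>|P|^2\<close> over \<open>m\<close> equally spaced points of
  the circle is exactly the sum of the weighted squares, since exponents differ by less than
  \<open>m\<close> and no aliasing occurs. Truncation costs at most the tail \<open>e m\<close>,
  which tends to 0.\<close>

lemma sum_norm_square_le_of_circle_bound:
  assumes holo: "h holomorphic_on ball 0 1" and r: "0 \<le> r" "r < 1"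
    and M: "\<And>z. norm z = r \<Longrightarrow> norm (h z) \<le> M"
  shows "(\<Sum>n<N. norm (taylor_coeff h n) ^ 2 * r ^ (2 * n)) \<le> M ^ 2"
proof -
  define c where "c n = taylor_coeff h n" for n
  define e where "e m = (\<Sum>n. norm (c (n + m)) * r ^ (n + m))" for m
  have sm: "summable (\<lambda>n. norm (c n) * r ^ n)"
    unfolding c_def by (rule taylor_coeff_abs_summable[OF holo r])
  have e0: "e \<longlonglongrightarrow> 0"
    unfolding e_def using suminf_exist_split2[OF sm] by simp
  have M0: "M \<ge> 0" using M[of "of_real r"] r by (smt (verit) norm_ge_zero norm_of_real)
  have bound: "(\<Sum>n<m. norm (c n) ^ 2 * r ^ (2 * n)) \<le> (M + e m) ^ 2" if m: "m > 0" for m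
  proof -
    define P where "P z = (\<Sum>n<m. c n * z ^ n)" for z
    define x where "x k = of_real r * cis (2 * pi * k / m)" for k :: nat
    have Pb: "norm (P z) \<le> M + e m" if z: "norm z = r" for z
    proof -
      have s: "(\<lambda>n. c n * z ^ n) sums h z"
        unfolding c_def by (rule taylor_coeff_sums[OF holo]) (use z r in simp)
      have "h z = (\<Sum>n. c (n + m) * z ^ (n + m)) + P z"
        using suminf_split_initial_segment[OF sums_summable[OF s], of m] sums_unique[OF s]
        by (simp add: P_def)
      then have "P z = h z - (\<Sum>n. c (n + m) * z ^ (n + m))" by simp
      then have "norm (P z) \<le> norm (h z) + norm (\<Sum>n. c (n + m) * z ^ (n + m))"
        by (simp add: norm_triangle_ineq4)
      also have "norm (\<Sum>n. c (n + m) * z ^ (n + m)) \<le> (\<Sum>n. norm (c (n + m) * z ^ (n + m)))"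
        by (intro summable_norm) (use sm summable_ignore_initial_segment[OF sm, of m] z in \<open>simp add: norm_mult norm_power\<close>)
      also have "\<dots> = e m" using z by (simp add: e_def norm_mult norm_power)
      finally show ?thesis using M[OF z] by simp
    qed
    have orth: "(\<Sum>k<m. x k ^ i * cnj (x k ^ j)) = (if i = j then of_nat m * of_real (r ^ (2 * i)) else 0)"
      if ij: "i < m" "j < m" for i j
    proof -
      have *: "(\<Sum>k<m. x k ^ i * cnj (x k ^ j)) = (if i = j then of_nat m * of_real (r ^ (2 * i)) else 0)"
        if "j \<le> i" "i < m" for i j
      proof -
        have "x k ^ i * cnj (x k ^ j) = of_real (r ^ (i + j)) * cis (2 * pi * k / m) ^ (i - j)" for k
        proof -
          have "cis (2 * pi * k / m) ^ i = cis (2 * pi * k / m) ^ (i - j) * cis (2 * pi * k / m) ^ j"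
            using that by (simp add: power_add[symmetric])
          moreover have "cis (2 * pi * k / m) ^ j * cnj (cis (2 * pi * k / m) ^ j) = 1"
            by (simp add: power_mult_distrib[symmetric] cis_cnj cis_mult)
          ultimately show ?thesis
            by (simp add: x_def power_mult_distrib power_add mult_ac)
        qed
        then have "(\<Sum>k<m. x k ^ i * cnj (x k ^ j)) = of_real (r ^ (i + j)) * (if m dvd (i - j) then of_nat m else 0)"
          by (simp add: sum_distrib_left[symmetric] sum_roots_of_unity_powers[OF m] del: of_real_power)
        moreover have "m dvd (i - j) \<longleftrightarrow> i = j"
          using that by (auto dest: dvd_imp_le)
        ultimately show ?thesis by (auto simp: mult_2)
      qed
      show ?thesis
      proof (cases "j \<le> i")
        case True then show ?thesis using * ij by auto
      next
        case False
        have "(\<Sum>k<m. x k ^ i * cnj (x k ^ j)) = cnj (\<Sum>k<m. x k ^ j * cnj (x k ^ i))"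
          by (simp add: mult.commute)
        then show ?thesis using *[of i j] False ij by (simp del: cnj_sum)
      qed
    qed
    have "complex_of_real (\<Sum>k<m. norm (P (x k)) ^ 2) = (\<Sum>k<m. P (x k) * cnj (P (x k)))"
      by (simp only: of_real_sum complex_norm_square)
    also have "\<dots> = (\<Sum>k<m. \<Sum>i<m. \<Sum>j<m. c i * cnj (c j) * (x k ^ i * cnj (x k ^ j)))"
      unfolding P_def by (simp add: sum_product mult_ac)
    also have "\<dots> = (\<Sum>i<m. \<Sum>j<m. \<Sum>k<m. c i * cnj (c j) * (x k ^ i * cnj (x k ^ j)))"
      proof -
      have "(\<Sum>k<m. \<Sum>i<m. \<Sum>j<m. g k i j) = (\<Sum>i<m. \<Sum>j<m. \<Sum>k<m. g k i j)" for g :: "nat \<Rightarrow> nat \<Rightarrow> nat \<Rightarrow> complex"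
      proof -
        have "(\<Sum>k<m. \<Sum>i<m. \<Sum>j<m. g k i j) = (\<Sum>i<m. \<Sum>k<m. \<Sum>j<m. g k i j)"
          by (rule sum.swap)
        also have "\<dots> = (\<Sum>i<m. \<Sum>j<m. \<Sum>k<m. g k i j)"
          using sum.swap[of "\<lambda>k j. g k i j" "{..<m}" "{..<m}" for i] by presburger
        finally show ?thesis .
      qed
      then show ?thesis .
    qed
    also have "\<dots> = (\<Sum>i<m. \<Sum>j<m. c i * cnj (c j) * (if i = j then of_nat m * of_real (r ^ (2 * i)) else 0))"
      by (intro sum.cong refl) (simp only: sum_distrib_left[symmetric] orth lessThan_iff)
    also have "\<dots> = (\<Sum>i<m. of_nat m * (c i * cnj (c i)) * of_real (r ^ (2 * i)))"
      by (intro sum.cong refl) (simp add: if_distrib mult_ac cong: if_cong)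
    also have "\<dots> = complex_of_real (real m * (\<Sum>n<m. norm (c n) ^ 2 * r ^ (2 * n)))"
      by (simp add: complex_norm_square[symmetric] sum_distrib_left mult_ac)
    finally have "real m * (\<Sum>n<m. norm (c n) ^ 2 * r ^ (2 * n)) = (\<Sum>k<m. norm (P (x k)) ^ 2)"
      by (simp only: of_real_eq_iff)
    also have "\<dots> \<le> (\<Sum>k<m. (M + e m) ^ 2)"
      by (intro sum_mono power_mono Pb) (use r in \<open>auto simp: x_def norm_mult\<close>)
    finally show ?thesis using m by simp
  qed
  have "(\<lambda>m. (M + e m) ^ 2) \<longlonglongrightarrow> (M + 0) ^ 2"
    by (intro tendsto_intros e0)
  then have "(\<Sum>n<N. norm (c n) ^ 2 * r ^ (2 * n)) \<le> (M + 0) ^ 2"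
  proof (rule tendsto_lowerbound)
    have "\<forall>\<^sub>F m in sequentially. m > N" by (rule eventually_gt_at_top)
    then show "\<forall>\<^sub>F m in sequentially. (\<Sum>n<N. norm (c n) ^ 2 * r ^ (2 * n)) \<le> (M + e m) ^ 2"
    proof eventually_elim
      case (elim m)
      have "(\<Sum>n<N. norm (c n) ^ 2 * r ^ (2 * n)) \<le> (\<Sum>n<m. norm (c n) ^ 2 * r ^ (2 * n))"
        by (intro sum_mono2) (use elim r in auto)
      also have "\<dots> \<le> (M + e m) ^ 2" using elim by (intro bound) auto
      finally show ?case .
    qed
  qed auto
  then show ?thesis by (simp add: c_def)
qed

section \<open>Areas of holomorphic images\<close>

text \<open>Areas are computed in \<open>real^2\<close>, where the change of variables formula is
  expressed by determinants of matrices.\<close>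

definition complex_of_vec :: "real^2 \<Rightarrow> complex" where
  "complex_of_vec v = Complex (v $ 1) (v $ 2)"

definition vec_of_complex :: "complex \<Rightarrow> real^2" where
  "vec_of_complex z = vector [Re z, Im z]"

lemma vec_of_complex_nth [simp]: "vec_of_complex z $ 1 = Re z" "vec_of_complex z $ 2 = Im z"
  by (simp_all add: vec_of_complex_def)

lemma complex_of_vec_sel [simp]: "Re (complex_of_vec v) = v $ 1" "Im (complex_of_vec v) = v $ 2"
  by (simp_all add: complex_of_vec_def)

lemma complex_of_vec_inverse [simp]: "vec_of_complex (complex_of_vec v) = v"
  by (simp add: vec_eq_iff forall_2)

lemma vec_of_complex_inverse [simp]: "complex_of_vec (vec_of_complex z) = z"
  by (simp add: complex_eq_iff)

lemma bounded_linear_complex_of_vec: "bounded_linear complex_of_vec"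
  by (rule linear_conv_bounded_linear[THEN iffD1])
     (auto intro!: linearI simp: complex_eq_iff)

lemma bounded_linear_vec_of_complex: "bounded_linear vec_of_complex"
  by (rule linear_conv_bounded_linear[THEN iffD1])
     (auto intro!: linearI simp: vec_eq_iff forall_2)

lemma mem_cbox_vec2:
  fixes v :: "real^2"
  shows "v \<in> cbox a b \<longleftrightarrow> a $ 1 \<le> v $ 1 \<and> v $ 1 \<le> b $ 1 \<and> a $ 2 \<le> v $ 2 \<and> v $ 2 \<le> b $ 2"
  by (auto simp: mem_box_cart forall_2)

lemma content_cbox_vec2:
  fixes a b :: "real^2"
  assumes "a $ 1 \<le> b $ 1" "a $ 2 \<le> b $ 2"
  shows "measure lborel (cbox a b) = (b $ 1 - a $ 1) * (b $ 2 - a $ 2)"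
  using assms interval_ne_empty_cart[of a b]
  by (subst content_cbox_if_cart) (auto simp: forall_2 UNIV_2)

text \<open>Fubini in coordinates: the identification \<open>k\<close> of pairs with vectors maps
  boxes to boxes of the same content, so the integral carries over to a product box and can be
  iterated there.\<close>

lemma integral_cbox_vec2:
  fixes g :: "real^2 \<Rightarrow> real"
  assumes "continuous_on (cbox a b) g"
  shows "integral (cbox a b) g =
    integral {a $ 1..b $ 1} (\<lambda>x. integral {a $ 2..b $ 2} (\<lambda>y. g (vec_of_complex (Complex x y))))"
proof -
  define k :: "real \<times> real \<Rightarrow> real^2" where "k p = vec_of_complex (Complex (fst p) (snd p))" for p
  define h :: "real^2 \<Rightarrow> real \<times> real" where "h v = (v $ 1, v $ 2)" for v
  have hk: "h (k p) = p" and kh: "k (h v) = v" for p v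
    by (auto simp: h_def k_def vec_eq_iff forall_2)
  have k_lin: "linear k"
    by (auto intro!: linearI simp: k_def vec_eq_iff forall_2)
  then have k_cont: "isCont k p" for p
    by (simp add: linear_continuous_at linear_conv_bounded_linear)
  have k_box: "k ` cbox u v = cbox (k u) (k v)" for u v
  proof (rule set_eqI)
    fix x show "x \<in> k ` cbox u v \<longleftrightarrow> x \<in> cbox (k u) (k v)"
      using hk kh[of x] by (cases u; cases v) (force simp: mem_cbox_vec2 k_def h_def image_iff)
  qed
  have h_box: "h ` cbox u v = cbox (h u) (h v)" for u v
  proof (rule set_eqI)
    fix x show "x \<in> h ` cbox u v \<longleftrightarrow> x \<in> cbox (h u) (h v)"
    proof -
      have "x \<in> h ` cbox u v \<longleftrightarrow> k x \<in> cbox u v" by (metis hk kh image_iff)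
      also have "\<dots> \<longleftrightarrow> x \<in> cbox (h u) (h v)"
        by (cases x) (auto simp: mem_cbox_vec2 k_def h_def)
      finally show ?thesis .
    qed
  qed
  have cont: "measure lborel (k ` cbox u v) = 1 * measure lborel (cbox u v)" for u v
  proof -
    obtain u1 u2 v1 v2 where [simp]: "u = (u1, u2)" "v = (v1, v2)" by (metis surj_pair)
    have "measure lborel (cbox (k u) (k v)) = measure lborel (cbox u1 v1) * measure lborel (cbox u2 v2)"
      using interval_ne_empty_cart[of "k u" "k v"]
      by (subst content_cbox_if_cart) (auto simp: forall_2 UNIV_2 k_def content_real_if)
    then show ?thesis by (simp add: k_box content_Pair)
  qed
  have "(g has_integral integral (cbox a b) g) (cbox a b)"
    using assms integrable_continuous by blast
  moreover have "\<exists>w z. k ` cbox u v = cbox w z" "\<exists>w z. h ` cbox u' v' = cbox w z" for u v u' v'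
    using k_box h_box by blast+
  ultimately have "((\<lambda>p. g (k p)) has_integral (1 / 1) *\<^sub>R integral (cbox a b) g) (h ` cbox a b)"
    by (intro has_integral_twiddle[OF zero_less_one hk kh k_cont _ _ cont])
  then have "((\<lambda>p. g (k p)) has_integral integral (cbox a b) g) (cbox (h a) (h b))"
    by (simp add: h_box)
  then have "integral (cbox a b) g = integral (cbox (h a) (h b)) (\<lambda>p. g (k p))"
    by (simp add: integral_unique)
  also have "\<dots> = integral {a $ 1..b $ 1} (\<lambda>x. integral {a $ 2..b $ 2} (\<lambda>y. g (k (x, y))))"
    unfolding h_def
  proof (subst integral_prod_continuous)
    have "k ` cbox (a $ 1, a $ 2) (b $ 1, b $ 2) = cbox a b"
      using k_box[of "h a" "h b"] by (simp add: kh) (simp add: h_def)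
    then show "continuous_on (cbox (a $ 1, a $ 2) (b $ 1, b $ 2)) (\<lambda>p. g (k p))"
      by (intro continuous_on_compose2[OF assms])
         (auto intro!: linear_continuous_on k_lin simp: linear_conv_bounded_linear[symmetric])
  qed (simp add: cbox_interval)
  finally show ?thesis by (simp add: k_def)
qed

text \<open>By the Cauchy--Riemann equations the real Jacobian determinant of \<open>f\<close> is
  \<open>|f'|^2\<close>, and injectivity ensures that no region is counted twice.\<close>

lemma area_holomorphic_image:
  fixes f :: "complex \<Rightarrow> complex" and a b :: "real^2"
  assumes holo: "f holomorphic_on U" and U: "open U" and inj: "inj_on f U"
    and sub: "complex_of_vec ` cbox a b \<subseteq> U"
  defines "F \<equiv> (\<lambda>v. vec_of_complex (f (complex_of_vec v)))"
  shows "F ` cbox a b \<in> lmeasurable"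
    "measure lebesgue (F ` cbox a b) = integral (cbox a b) (\<lambda>v. norm (deriv f (complex_of_vec v)) ^ 2)"
    "(\<lambda>v. norm (deriv f (complex_of_vec v)) ^ 2) integrable_on cbox a b"
proof -
  define F' where "F' v h = vec_of_complex (deriv f (complex_of_vec v) * complex_of_vec h)" for v h
  have der: "(F has_derivative F' v) (at v within cbox a b)" if "v \<in> cbox a b" for v
  proof -
    have "(f has_field_derivative deriv f (complex_of_vec v)) (at (complex_of_vec v))"
      using holomorphic_derivI[OF holo U] sub that by blast
    then have "(f has_derivative (\<lambda>h. deriv f (complex_of_vec v) * h)) (at (complex_of_vec v))"
      by (simp add: has_field_derivative_def)
    moreover have "(complex_of_vec has_derivative complex_of_vec) (at v within cbox a b)"
      by (rule bounded_linear_imp_has_derivative[OF bounded_linear_complex_of_vec])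
    ultimately have "((\<lambda>v. f (complex_of_vec v)) has_derivative (\<lambda>h. deriv f (complex_of_vec v) * complex_of_vec h)) (at v within cbox a b)"
      by (rule has_derivative_compose[rotated])
    then show ?thesis
      unfolding F_def F'_def by (rule bounded_linear.has_derivative[OF bounded_linear_vec_of_complex])
  qed
  have det: "\<bar>det (matrix (F' v))\<bar> = norm (deriv f (complex_of_vec v)) ^ 2" for v
    unfolding cmod_power2 by (simp add: det_2 matrix_def F'_def axis_def power2_eq_square)
  have injF: "inj_on F (cbox a b)"
  proof (rule inj_onI)
    fix v w assume *: "v \<in> cbox a b" "w \<in> cbox a b" "F v = F w"
    then have "f (complex_of_vec v) = f (complex_of_vec w)"
      by (metis F_def vec_of_complex_inverse)
    then have "complex_of_vec v = complex_of_vec w"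
      using inj sub * by (auto dest: inj_onD)
    then show "v = w" by (metis complex_of_vec_inverse)
  qed
  have cont: "continuous_on (cbox a b) (\<lambda>v. norm (deriv f (complex_of_vec v)) ^ 2)"
    by (intro continuous_intros continuous_on_compose2[OF holomorphic_on_imp_continuous_on[OF holomorphic_deriv[OF holo U]]]
        linear_continuous_on bounded_linear_complex_of_vec sub)
  then show int: "(\<lambda>v. norm (deriv f (complex_of_vec v)) ^ 2) integrable_on cbox a b"
    by (rule integrable_continuous)
  have S: "cbox a b \<in> sets lebesgue" by simp
  show "F ` cbox a b \<in> lmeasurable"
    using measurable_differentiable_image_eq[OF S der injF] int by (simp add: det)
  show "measure lebesgue (F ` cbox a b) = integral (cbox a b) (\<lambda>v. norm (deriv f (complex_of_vec v)) ^ 2)"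
    using measure_differentiable_image_eq[OF S der injF] int by (simp add: det)
qed

text \<open>
  The area is the integral of \<open>|\<Lambda>'|\<^sup>2 \<ge> 2 Re \<Lambda>' - 1\<close>, and the mean of \<open>Re \<Lambda>'\<close> over a period is 1.
\<close>

lemma area_logarithmic_image_ge:
  fixes \<psi> :: "complex \<Rightarrow> complex" and x0 x1 :: real and N :: nat
  assumes holo: "\<psi> holomorphic_on ball 0 1" and x: "x0 < x1" "x1 < 0"
  defines "\<Lambda> \<equiv> (\<lambda>\<zeta>. \<zeta> + \<psi> (exp \<zeta>))"
  defines "R \<equiv> cbox (vec_of_complex (Complex x0 0)) (vec_of_complex (Complex x1 (2 * pi * N)))"
  assumes int: "(\<lambda>v. norm (deriv \<Lambda> (complex_of_vec v)) ^ 2) integrable_on R"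
  shows "integral R (\<lambda>v. norm (deriv \<Lambda> (complex_of_vec v)) ^ 2) \<ge> (x1 - x0) * (2 * pi * N)"
proof -
  have ex: "exp \<zeta> \<in> ball 0 1" if "Re \<zeta> < 0" for \<zeta> :: complex
    using that by simp
  have der\<psi>: "((\<lambda>\<zeta>. \<psi> (exp \<zeta>)) has_field_derivative (deriv \<psi> (exp \<zeta>) * exp \<zeta>)) (at \<zeta>)" if "Re \<zeta> < 0" for \<zeta>
    by (rule DERIV_chain2[OF holomorphic_derivI[OF holo open_ball ex[OF that]] DERIV_exp])
  have der: "deriv \<Lambda> \<zeta> = 1 + deriv \<psi> (exp \<zeta>) * exp \<zeta>" if "Re \<zeta> < 0" for \<zeta>
    unfolding \<Lambda>_def by (intro DERIV_imp_deriv DERIV_add DERIV_ident der\<psi> that)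
  define q where "q \<zeta> = Re (deriv \<psi> (exp \<zeta>) * exp \<zeta>)" for \<zeta>
  have R: "Re (complex_of_vec v) < 0" if "v \<in> R" for v
    using that x by (auto simp: R_def mem_cbox_vec2)
  have contq: "continuous_on R (\<lambda>v. q (complex_of_vec v))"
    unfolding q_def
    by (intro continuous_intros continuous_on_compose2[OF holomorphic_on_imp_continuous_on[OF holomorphic_deriv[OF holo open_ball]]]
        linear_continuous_on bounded_linear_complex_of_vec) (use R in auto)
  then have intq: "(\<lambda>v. q (complex_of_vec v)) integrable_on R"
    unfolding R_def by (rule integrable_continuous)
  \<comment> \<open>On a vertical line \<open>q\<close> is the \<open>y\<close>-derivative of
    \<open>Im (\<psi> (exp (Complex s y)))\<close>. Over \<open>N\<close> full periods the integral
    vanishes because \<open>exp\<close> agrees at both ends.\<close>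
  have inner: "((\<lambda>y. q (Complex s y)) has_integral 0) {0..2 * pi * N}" if "s < 0" for s
  proof -
    have "((\<lambda>y. Im (\<psi> (exp (Complex s y)))) has_vector_derivative q (Complex s y)) (at y within {0..2 * pi * N})" for y
    proof -
      have "((\<lambda>y. Complex s y) has_vector_derivative \<i>) (at y within {0..2 * pi * N})"
      proof -
        have "((\<lambda>y. of_real s + \<i> * of_real y) has_vector_derivative \<i>) (at y within {0..2 * pi * N})"
          by (auto intro!: derivative_eq_intros)
        then show ?thesis by (simp add: Complex_eq)
      qed
      then have "((\<lambda>y. \<psi> (exp (Complex s y))) has_vector_derivative (\<i> * (deriv \<psi> (exp (Complex s y)) * exp (Complex s y)))) (at y within {0..2 * pi * N})"
        using field_vector_diff_chain_within[where g = "\<lambda>\<zeta>. \<psi> (exp \<zeta>)",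
            OF _ has_field_derivative_at_within[OF der\<psi>]] that
        by (simp add: o_def)
      then have "((\<lambda>y. Im (\<psi> (exp (Complex s y)))) has_vector_derivative Im (\<i> * (deriv \<psi> (exp (Complex s y)) * exp (Complex s y)))) (at y within {0..2 * pi * N})"
        by (rule bounded_linear.has_vector_derivative[OF bounded_linear_Im])
      then show ?thesis by (simp add: q_def)
    qed
    then have "((\<lambda>y. q (Complex s y)) has_integral (Im (\<psi> (exp (Complex s (2 * pi * N)))) - Im (\<psi> (exp (Complex s 0))))) {0..2 * pi * N}"
      by (intro fundamental_theorem_of_calculus) auto
    moreover have "exp (Complex s (2 * pi * N)) = exp (Complex s 0)"
      by (simp add: exp_eq Complex_eq) (rule exI[of _ "int N"], simp)
    ultimately show ?thesis by simp
  qed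
  have "integral R (\<lambda>v. q (complex_of_vec v)) = integral {x0..x1} (\<lambda>s. integral {0..2 * pi * N} (\<lambda>y. q (Complex s y)))"
    using integral_cbox_vec2[OF contq[unfolded R_def]] by (simp add: R_def)
  also have "\<dots> = integral {x0..x1} (\<lambda>s. 0)"
    by (intro integral_cong integral_unique inner) (use x in auto)
  finally have q0: "integral R (\<lambda>v. q (complex_of_vec v)) = 0" by simp
  have "(x1 - x0) * (2 * pi * N) = integral R (\<lambda>v. 1 + 2 * q (complex_of_vec v))"
  proof -
    have "integral R (\<lambda>v. 1 + 2 * q (complex_of_vec v)) = integral R (\<lambda>v. 1) + integral R (\<lambda>v. 2 * q (complex_of_vec v))"
      unfolding R_def by (intro Henstock_Kurzweil_Integration.integral_add integrable_continuous
          continuous_intros contq[unfolded R_def])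
    also have "integral R (\<lambda>v. 2 * q (complex_of_vec v)) = 0" using q0 by simp
    finally show ?thesis using x by (simp add: R_def content_cbox_vec2)
  qed
  also have "\<dots> \<le> integral R (\<lambda>v. norm (deriv \<Lambda> (complex_of_vec v)) ^ 2)"
  proof (rule integral_le)
    show "(\<lambda>v. 1 + 2 * q (complex_of_vec v)) integrable_on R"
      unfolding R_def by (intro integrable_continuous continuous_intros contq[unfolded R_def])
    fix v assume "v \<in> R"
    then have "norm (deriv \<Lambda> (complex_of_vec v)) ^ 2 = (1 + q (complex_of_vec v)) ^ 2 + Im (deriv \<Lambda> (complex_of_vec v)) ^ 2"
      using der[OF R] by (simp add: cmod_power2 q_def)
    also have "\<dots> \<ge> 1 + 2 * q (complex_of_vec v)"
      by (simp add: power2_sum)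
    finally show "1 + 2 * q (complex_of_vec v) \<le> norm (deriv \<Lambda> (complex_of_vec v)) ^ 2" .
  qed (rule int)
  finally show ?thesis .
qed

section \<open>The Koebe quarter theorem\<close>

text \<open>
  In logarithmic coordinates \<open>T\<close> becomes a univalent map \<open>\<Lambda>\<close> of the left half plane commuting with
  translation by \<open>2\<pi>i\<close>. The image \<open>E\<close> of a rectangle of \<open>N\<close> periods has at least the area of the
  rectangle, and the condition on \<open>T\<close> makes \<open>E\<close> and \<open>2\<pi>iN - E\<close> disjoint. If \<open>|T'(0)| > 1\<close>, both
  lie in a box too small to hold them once \<open>N\<close> is large.
\<close>

lemma bieberbach_eilenberg_univalent:
  assumes holo: "T holomorphic_on ball 0 1" and inj: "inj_on T (ball 0 1)" and T0: "T 0 = 0"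
    and no_inv: "\<And>z w. norm z < 1 \<Longrightarrow> norm w < 1 \<Longrightarrow> T z * T w \<noteq> 1"
  shows "norm (deriv T 0) \<le> 1"
proof (rule ccontr)
  assume gt: "\<not> norm (deriv T 0) \<le> 1"
  \<comment> \<open>\<open>k\<close> extends \<open>T z / z\<close> across 0 and has no zeros
    because \<open>T\<close> is injective with nonzero derivative at 0. With \<open>\<psi>\<close> a
    logarithm of \<open>k\<close>, the map \<open>\<Lambda>\<close> below is a logarithm of
    \<open>T (exp \<zeta>)\<close>, and \<open>l = ln |T'(0)|\<close> is its limiting horizontal
    shift far to the left.\<close>
  define k where "k z = (if z = 0 then deriv T 0 else T z / z)" for z
  have hk: "k holomorphic_on ball 0 1"
    unfolding k_def using pole_lemma[OF holo, of 0] T0 by (simp cong: if_cong)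
  have k: "T z = z * k z" for z by (simp add: k_def T0)
  have "k z \<noteq> 0" if "z \<in> ball 0 1" for z
    using inj_onD[OF inj, of z 0] that gt T0 by (auto simp: k_def)
  moreover have "simply_connected (ball (0::complex) 1)"
    by (simp add: convex_imp_simply_connected)
  ultimately obtain \<psi> where h\<psi>: "\<psi> holomorphic_on ball 0 1" and \<psi>: "\<And>z. z \<in> ball 0 1 \<Longrightarrow> k z = exp (\<psi> z)"
    using hk simply_connected_eq_holomorphic_log[OF open_ball, of "0::complex" 1] by metis
  define l where "l = Re (\<psi> 0)"
  have "norm (deriv T 0) = exp l" using \<psi>[of 0] by (simp add: k_def l_def)
  then have l: "l > 0" using gt by (metis exp_le_one_iff not_le)
  \<comment> \<open>The excess \<open>l\<close> is split in three: one share moves the right edge to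
    \<open>x1 = - g\<close>, one absorbs the variation of \<open>\<psi>\<close> near 0, and the last
    remains as the surplus in \<open>x1 - x0 = M + g\<close>.\<close>
  define g where "g = l / 3"
  have g: "g > 0" using l by (simp add: g_def)
  define x1 where "x1 = - g"
  have "continuous_on (cball 0 (exp x1)) \<psi>"
    by (rule holomorphic_on_imp_continuous_on[OF holomorphic_on_subset[OF h\<psi>]])
       (use g in \<open>simp add: x1_def cball_subset_ball_iff\<close>)
  then have "compact (\<psi> ` cball 0 (exp x1))" by (intro compact_continuous_image) auto
  then have "bounded (\<psi> ` cball 0 (exp x1))" by (rule compact_imp_bounded)
  then obtain B where "\<forall>y\<in>\<psi> ` cball 0 (exp x1). norm y \<le> B"
    unfolding bounded_iff by blast
  then have B: "norm (\<psi> z) \<le> B" if "norm z \<le> exp x1" for z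
    using that by auto
  have "isCont \<psi> 0"
    using holomorphic_on_imp_continuous_on[OF h\<psi>] continuous_on_eq_continuous_at[OF open_ball, of 0 1 \<psi>] by simp
  then obtain \<delta> where \<delta>: "\<delta> > 0" "\<And>z. norm z < \<delta> \<Longrightarrow> norm (\<psi> z - \<psi> 0) < g"
    using g unfolding continuous_at_eps_delta by (auto simp: dist_norm)
  define X where "X = ln \<delta> - 1"
  have X: "norm (\<psi> (exp \<zeta>) - \<psi> 0) < g" if "Re \<zeta> \<le> X" for \<zeta>
  proof -
    have "exp (Re \<zeta>) < exp (ln \<delta>)" using that by (simp add: X_def del: exp_ln)
    then show ?thesis using \<delta> by (intro \<delta>(2)) simp
  qed
  \<comment> \<open>Over the strip, the first bound gives
    \<open>Re (\<Lambda> \<zeta>) \<ge> - M\<close> when \<open>Re \<zeta> > X\<close>, the second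
    gives \<open>Re (\<Lambda> \<zeta>) \<le> M\<close>, and the third gives \<open>x0 < x1\<close>.
    When \<open>Re \<zeta> \<le> X\<close>, \<open>\<psi>\<close> is within \<open>g\<close> of
    \<open>\<psi> 0\<close>, so the real part is at least \<open>x0 + l - g = - M\<close>.\<close>
  define x0 where "x0 = min (min (X - B - l + g) (- x1 - B - l + g)) (x1 - 1)"
  define M where "M = - (x0 + l - g)"
  have x0: "x0 < x1" by (simp add: x0_def)
  have x1: "x1 < 0" using g by (simp add: x1_def)
  have Mg: "x1 - x0 = M + g" by (simp add: M_def x1_def g_def)
  define U where "U = {\<zeta>. Re \<zeta> < 0}"
  define \<Lambda> where "\<Lambda> \<zeta> = \<zeta> + \<psi> (exp \<zeta>)" for \<zeta>
  have openU: "open U" by (simp add: U_def open_halfspace_Re_lt)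
  have ex: "exp \<zeta> \<in> ball 0 1" if "\<zeta> \<in> U" for \<zeta>
    using that by (simp add: U_def)
  have h\<Lambda>: "\<Lambda> holomorphic_on U"
    unfolding \<Lambda>_def
    by (intro holomorphic_intros holomorphic_on_compose_gen[OF _ h\<psi>, unfolded o_def]) (use ex in auto)
  have exp\<Lambda>: "exp (\<Lambda> \<zeta>) = T (exp \<zeta>)" if "\<zeta> \<in> U" for \<zeta>
    using \<psi>[OF ex[OF that]] by (simp add: \<Lambda>_def k exp_add)
  have inj\<Lambda>: "inj_on \<Lambda> U"
  proof (rule inj_onI)
    fix v w assume *: "v \<in> U" "w \<in> U" "\<Lambda> v = \<Lambda> w"
    then have "T (exp v) = T (exp w)" using exp\<Lambda> by metis
    then have "exp v = exp w" using inj_onD[OF inj] ex * by metis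
    then show "v = w" using * by (simp add: \<Lambda>_def)
  qed
  have Re\<Lambda>: "\<bar>Re (\<Lambda> \<zeta>)\<bar> \<le> M" if "x0 \<le> Re \<zeta>" "Re \<zeta> \<le> x1" for \<zeta>
  proof -
    have b: "norm (\<psi> (exp \<zeta>)) \<le> B" using that by (intro B) simp
    then have b': "\<bar>Re (\<psi> (exp \<zeta>))\<bar> \<le> B" using abs_Re_le_cmod order_trans by blast
    have "Re (\<Lambda> \<zeta>) \<le> M" using that b' by (simp add: \<Lambda>_def M_def x0_def)
    moreover have "Re (\<Lambda> \<zeta>) \<ge> - M"
    proof (cases "Re \<zeta> \<le> X")
      case True
      have "\<bar>Re (\<psi> (exp \<zeta>) - \<psi> 0)\<bar> < g" using X[OF True] abs_Re_le_cmod order_le_less_trans by blast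
      then show ?thesis using that by (simp add: \<Lambda>_def M_def l_def)
    next
      case False
      then show ?thesis using that b' by (simp add: \<Lambda>_def M_def x0_def)
    qed
    ultimately show ?thesis by simp
  qed
  have Im\<Lambda>: "\<bar>Im (\<Lambda> \<zeta>) - Im \<zeta>\<bar> \<le> B" if "x0 \<le> Re \<zeta>" "Re \<zeta> \<le> x1" for \<zeta>
  proof -
    have b: "norm (\<psi> (exp \<zeta>)) \<le> B" using that by (intro B) simp
    then show ?thesis using abs_Im_le_cmod order_trans by (fastforce simp: \<Lambda>_def)
  qed
  \<comment> \<open>Two disjoint images of area at least \<open>(M + g) * (2 * pi * N)\<close> each
    would have to fit into a box of area \<open>2 * M * (2 * pi * N + 2 * B)\<close>. The surplus
    grows with \<open>N\<close> while the boundary term \<open>4 * M * B\<close> is fixed; this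
    \<open>N\<close> rules the fit out.\<close>
  obtain N :: nat where N: "M * B / (pi * g) < real N" using reals_Archimedean2 by blast
  define R where "R = cbox (vec_of_complex (Complex x0 0)) (vec_of_complex (Complex x1 (2 * pi * N)))"
  define \<Lambda>' where "\<Lambda>' \<zeta> = of_real (2 * pi * N) * \<i> - \<Lambda> \<zeta>" for \<zeta>
  have h\<Lambda>': "\<Lambda>' holomorphic_on U" unfolding \<Lambda>'_def by (intro holomorphic_intros h\<Lambda>)
  have inj\<Lambda>': "inj_on \<Lambda>' U" using inj\<Lambda> by (auto simp: \<Lambda>'_def inj_on_def)
  have sub: "complex_of_vec ` R \<subseteq> U"
    using x1 by (auto simp: R_def U_def mem_cbox_vec2)
  define E where "E = (\<lambda>v. vec_of_complex (\<Lambda> (complex_of_vec v))) ` R"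
  define E' where "E' = (\<lambda>v. vec_of_complex (\<Lambda>' (complex_of_vec v))) ` R"
  note area = area_holomorphic_image[OF h\<Lambda> openU inj\<Lambda> sub[unfolded R_def]]
  note area' = area_holomorphic_image[OF h\<Lambda>' openU inj\<Lambda>' sub[unfolded R_def]]
  have "integral R (\<lambda>v. norm (deriv \<Lambda> (complex_of_vec v)) ^ 2) \<ge> (x1 - x0) * (2 * pi * N)"
    using area_logarithmic_image_ge[OF h\<psi> x0 x1, of N] area(3) by (simp add: R_def \<Lambda>_def[abs_def])
  then have mE: "measure lebesgue E \<ge> (x1 - x0) * (2 * pi * N)"
    using area(2) by (simp add: E_def R_def)
  have "deriv \<Lambda>' \<zeta> = - deriv \<Lambda> \<zeta>" if "\<zeta> \<in> U" for \<zeta>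
  proof (rule DERIV_imp_deriv)
    have "((\<lambda>\<zeta>. of_real (2 * pi * N) * \<i> - \<Lambda> \<zeta>) has_field_derivative 0 - deriv \<Lambda> \<zeta>) (at \<zeta>)"
      by (intro DERIV_diff DERIV_const holomorphic_derivI[OF h\<Lambda> openU that])
    then show "(\<Lambda>' has_field_derivative - deriv \<Lambda> \<zeta>) (at \<zeta>)"
      by (simp add: \<Lambda>'_def[abs_def])
  qed
  then have "integral R (\<lambda>v. norm (deriv \<Lambda>' (complex_of_vec v)) ^ 2) = integral R (\<lambda>v. norm (deriv \<Lambda> (complex_of_vec v)) ^ 2)"
    using sub by (intro integral_cong) auto
  then have mE': "measure lebesgue E' = measure lebesgue E"
    using area(2) area'(2) by (simp add: E_def E'_def R_def)
  have lmE: "E \<in> lmeasurable" "E' \<in> lmeasurable"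
    using area(1) area'(1) by (auto simp: E_def E'_def R_def)
  have disj: "E \<inter> E' = {}"
  proof (rule ccontr)
    assume "E \<inter> E' \<noteq> {}"
    then obtain v w where vw: "v \<in> R" "w \<in> R"
      and eq: "vec_of_complex (\<Lambda> (complex_of_vec v)) = vec_of_complex (\<Lambda>' (complex_of_vec w))"
      unfolding E_def E'_def by blast
    from arg_cong[OF eq, of complex_of_vec] have "\<Lambda> (complex_of_vec v) + \<Lambda> (complex_of_vec w) = of_real (2 * pi * N) * \<i>"
      by (simp add: \<Lambda>'_def)
    moreover have "exp (of_real (2 * pi * N) * \<i>) = 1"
      by (simp add: exp_eq_1) (rule exI[of _ "int N"], simp)
    ultimately have "exp (\<Lambda> (complex_of_vec v)) * exp (\<Lambda> (complex_of_vec w)) = 1"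
      by (simp only: flip: exp_add)
    moreover have U: "complex_of_vec v \<in> U" "complex_of_vec w \<in> U" using sub vw by blast+
    ultimately have "T (exp (complex_of_vec v)) * T (exp (complex_of_vec w)) = 1"
      by (simp only: exp\<Lambda>)
    moreover have "norm (exp (complex_of_vec v)) < 1" "norm (exp (complex_of_vec w)) < 1"
      using ex[OF U(1)] ex[OF U(2)] by (simp_all only: mem_ball_0)
    ultimately show False using no_inv by blast
  qed
  define Q :: "(real^2) set" where "Q = cbox (vec_of_complex (Complex (- M) (- B))) (vec_of_complex (Complex M (2 * pi * N + B)))"
  have B0: "B \<ge> 0" using B[of 0] order_trans[OF norm_ge_zero, of "\<psi> 0" B] by simp
  have M0: "M \<ge> 0" using Re\<Lambda>[of "of_real x0"] x0 by simp
  have EQ: "E \<union> E' \<subseteq> Q"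
  proof -
    have "vec_of_complex (\<Lambda> (complex_of_vec v)) \<in> Q" "vec_of_complex (\<Lambda>' (complex_of_vec v)) \<in> Q" if "v \<in> R" for v
      using that Re\<Lambda>[of "complex_of_vec v"] Im\<Lambda>[of "complex_of_vec v"]
      unfolding R_def Q_def mem_cbox_vec2 \<Lambda>'_def by simp_all linarith+
    then show ?thesis by (auto simp: E_def E'_def)
  qed
  have "2 * ((x1 - x0) * (2 * pi * N)) \<le> measure lebesgue E + measure lebesgue E'"
    unfolding mE' using mE by linarith
  also have "\<dots> = measure lebesgue (E \<union> E')"
    using measure_Un3[OF lmE] disj by simp
  also have "\<dots> \<le> measure lebesgue Q"
    using lmE by (intro measure_mono_fmeasurable[OF EQ]) (auto simp: Q_def intro: fmeasurableD)
  also have "\<dots> = 2 * M * (2 * pi * N + 2 * B)"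
    using M0 B0 by (simp add: Q_def content_cbox_vec2 algebra_simps)
  finally have "pi * N * g \<le> M * B"
    unfolding Mg by (simp add: algebra_simps)
  moreover have "M * B < pi * N * g"
    using N g by (simp add: field_simps)
  ultimately show False by simp
qed

text \<open>Since \<open>u = 1 - \<phi> / w\<close> is injective without zeros, its square root
  \<open>S\<close> with \<open>S 0 = 1\<close> never takes two opposite values. The Cayley transform
  turns \<open>S \<mapsto> - S\<close> into \<open>T \<mapsto> 1 / T\<close>, so
  \<open>bieberbach_eilenberg_univalent\<close> applies to \<open>T\<close>; the constant 4 comes
  from \<open>deriv T 0 = deriv \<phi> 0 / (4 * w)\<close>.\<close>

theorem koebe_quarter:
  assumes holo: "\<phi> holomorphic_on ball 0 1" and inj: "inj_on \<phi> (ball 0 1)" and \<phi>0: "\<phi> 0 = 0"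
    and w: "w \<notin> \<phi> ` ball 0 1"
  shows "norm (deriv \<phi> 0) \<le> 4 * norm w"
proof -
  have w0: "w \<noteq> 0" using w \<phi>0 by (metis centre_in_ball image_eqI zero_less_one)
  define u where "u z = 1 - \<phi> z / w" for z
  have hu: "u holomorphic_on ball 0 1" unfolding u_def by (intro holomorphic_intros holo) (use w0 in auto)
  have unz: "u z \<noteq> 0" if "z \<in> ball 0 1" for z
    using w w0 that by (auto simp: u_def)
  have "simply_connected (ball (0::complex) 1)"
    by (simp add: convex_imp_simply_connected)
  then obtain s0 where hs0: "s0 holomorphic_on ball 0 1" and s0: "\<And>z. z \<in> ball 0 1 \<Longrightarrow> u z = s0 z ^ 2"
    using hu unz simply_connected_eq_holomorphic_sqrt[OF open_ball, of "0::complex" 1] by metis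
  define S where "S z = s0 z / s0 0" for z
  have s00: "s0 0 ^ 2 = 1" using s0[of 0] by (simp add: u_def \<phi>0)
  then have s00': "s0 0 \<noteq> 0" by auto
  have hS: "S holomorphic_on ball 0 1" unfolding S_def using s00' by (intro holomorphic_intros hs0) auto
  have S: "S z ^ 2 = u z" if "z \<in> ball 0 1" for z
    using s0[OF that] s00 by (simp add: S_def power_divide)
  have S0: "S 0 = 1" using s00' by (simp add: S_def)
  have u_inj: "z = z'" if "z \<in> ball 0 1" "z' \<in> ball 0 1" "u z = u z'" for z z'
    using inj_onD[OF inj] that w0 by (simp add: u_def)
  have S_neg: "S z + S z' \<noteq> 0" if zz: "z \<in> ball 0 1" "z' \<in> ball 0 1" for z z'
  proof
    assume *: "S z + S z' = 0"
    then have "S z = - S z'" by (simp add: add_eq_0_iff2)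
    then have "u z = u z'" using S zz by (metis power2_minus)
    then have "z = z'" using u_inj zz by blast
    then have "S z = 0" using * by simp
    then show False using S[OF zz(1)] unz[OF zz(1)] by simp
  qed
  have S1: "1 + S z \<noteq> 0" if "z \<in> ball 0 1" for z
    using S_neg[of 0 z] that S0 by simp
  define T where "T z = (1 - S z) / (1 + S z)" for z
  have hT: "T holomorphic_on ball 0 1"
    unfolding T_def using S1 by (intro holomorphic_intros hS) auto
  have "inj_on T (ball 0 1)"
  proof (rule inj_onI)
    fix z z' :: complex assume *: "z \<in> ball 0 1" "z' \<in> ball 0 1" "T z = T z'"
    then have "(1 - S z) * (1 + S z') = (1 - S z') * (1 + S z)"
      using S1 by (simp add: T_def frac_eq_eq)
    then have "S z = S z'" by (simp add: algebra_simps)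
    then show "z = z'" using u_inj * S by metis
  qed
  moreover have "T z * T z' \<noteq> 1" if "norm z < 1" "norm z' < 1" for z z'
  proof
    assume "T z * T z' = 1"
    then have "(1 - S z) * (1 - S z') = (1 + S z) * (1 + S z')"
      using S1[of z] S1[of z'] that by (simp add: T_def)
    then have "2 * (S z + S z') = 0" by (simp add: algebra_simps)
    then have "S z + S z' = 0" by (simp only: mult_eq_0_iff) simp
    then show False using S_neg[of z z'] that by simp
  qed
  ultimately have "norm (deriv T 0) \<le> 1"
    using bieberbach_eilenberg_univalent[OF hT] by (simp add: T_def S0)
  moreover have "deriv T 0 = deriv \<phi> 0 / (4 * w)"
  proof -
    have dS: "(S has_field_derivative deriv S 0) (at 0)"
      by (rule holomorphic_derivI[OF hS]) auto
    have d\<phi>: "(\<phi> has_field_derivative deriv \<phi> 0) (at 0)"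
      by (rule holomorphic_derivI[OF holo]) auto
    have "((\<lambda>z. S z ^ 2) has_field_derivative 2 * deriv S 0) (at 0)"
      using S0 by (auto intro!: derivative_eq_intros dS)
    moreover have "(u has_field_derivative - (deriv \<phi> 0 / w)) (at 0)"
      unfolding u_def using w0 by (auto intro!: derivative_eq_intros d\<phi>)
    then have "((\<lambda>z. S z ^ 2) has_field_derivative - (deriv \<phi> 0 / w)) (at 0)"
      by (rule has_field_derivative_transform_within_open[of _ _ _ "ball 0 1"]) (use S in auto)
    ultimately have "2 * deriv S 0 = - (deriv \<phi> 0 / w)" by (rule DERIV_unique)
    then have "2 * deriv S 0 / 2 = - (deriv \<phi> 0 / w) / 2" by (simp only:)
    then have "deriv S 0 = - (deriv \<phi> 0 / (2 * w))" by simp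
    moreover have "(T has_field_derivative - (deriv S 0 / 2)) (at 0)"
      unfolding T_def using S0 by (auto intro!: derivative_eq_intros dS simp: field_simps)
    ultimately show ?thesis by (simp add: DERIV_imp_deriv)
  qed
  ultimately show ?thesis using w0 by (simp add: norm_divide norm_mult field_simps)
qed

text \<open>When \<open>\<Omega>\<close> is not the whole plane, its Riemann map, corrected by a
  disc automorphism \<open>m\<close> to fix 0, has derivative at most \<open>b\<close> in modulus
  there. The inverse \<open>\<phi>\<close> then has derivative at least \<open>1 / b\<close> in
  modulus, and \<open>koebe_quarter\<close> keeps omitted points at distance at least
  \<open>1 / (4 * b)\<close>.\<close>

lemma ball_subset_simply_connected:
  assumes op: "open \<Omega>" and sc: "simply_connected \<Omega>" and zero: "0 \<in> \<Omega>" and b: "b > 0"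
    and deriv_le: "\<And>f. f holomorphic_on \<Omega> \<Longrightarrow> (\<And>z. z \<in> \<Omega> \<Longrightarrow> norm (f z) < 1) \<Longrightarrow> f 0 = 0 \<Longrightarrow> norm (deriv f 0) \<le> b"
  shows "ball 0 (1 / (4 * b)) \<subseteq> \<Omega>"
proof (cases "\<Omega> = UNIV")
  case False
  then obtain f g where f: "f holomorphic_on \<Omega>" and g: "g holomorphic_on ball 0 1"
    and fg: "\<And>z. z \<in> \<Omega> \<Longrightarrow> f z \<in> ball 0 1 \<and> g (f z) = z"
    and gf: "\<And>z. z \<in> ball 0 1 \<Longrightarrow> g z \<in> \<Omega> \<and> f (g z) = z"
    using simply_connected_eq_biholomorphic_to_disc[OF op] sc zero by blast
  obtain m m' where m0: "m (f 0) = 0" and m: "m holomorphic_on ball 0 1" "m ` ball 0 1 \<subseteq> ball 0 1"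
    and m': "m' holomorphic_on ball 0 1" "m' ` ball 0 1 \<subseteq> ball 0 1"
    and mm': "\<And>z. z \<in> ball 0 1 \<Longrightarrow> m (m' z) = z" and m'm: "\<And>z. z \<in> ball 0 1 \<Longrightarrow> m' (m z) = z"
    using ball_biholomorphism_exists[of "f 0"] fg[OF zero] by metis
  define F where "F z = m (f z)" for z
  define \<phi> where "\<phi> z = g (m' z)" for z
  have hF: "F holomorphic_on \<Omega>"
    unfolding F_def using fg by (intro holomorphic_on_compose_gen[OF f m(1), unfolded o_def]) auto
  have h\<phi>: "\<phi> holomorphic_on ball 0 1"
    unfolding \<phi>_def by (intro holomorphic_on_compose_gen[OF m'(1) g m'(2), unfolded o_def])
  have F_ball: "F z \<in> ball 0 1" if "z \<in> \<Omega>" for z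
    using m(2) fg[OF that] unfolding F_def by blast
  have \<phi>_mem: "\<phi> z \<in> \<Omega>" if "z \<in> ball 0 1" for z
    using m'(2) gf that unfolding \<phi>_def by blast
  have F\<phi>: "F (\<phi> z) = z" if "z \<in> ball 0 1" for z
    using m'(2) gf mm' that by (auto simp: F_def \<phi>_def image_subset_iff)
  have \<phi>F: "\<phi> (F z) = z" if "z \<in> \<Omega>" for z
    using fg[OF that] m'm by (auto simp: F_def \<phi>_def)
  have F0: "F 0 = 0" by (simp add: F_def m0)
  then have \<phi>0: "\<phi> 0 = 0" using \<phi>F[OF zero] by simp
  have inj: "inj_on \<phi> (ball 0 1)" using F\<phi> by (metis inj_onI)
  have "((\<lambda>z. F (\<phi> z)) has_field_derivative deriv F 0 * deriv \<phi> 0) (at 0)"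
    using DERIV_chain2[of F "deriv F 0" \<phi> 0 "deriv \<phi> 0"] holomorphic_derivI[OF hF op zero]
      holomorphic_derivI[OF h\<phi> open_ball, of 0] \<phi>0 by simp
  moreover have "((\<lambda>z. F (\<phi> z)) has_field_derivative 1) (at 0)"
    by (rule has_field_derivative_transform_within_open[OF DERIV_ident open_ball, of _ 0 1]) (use F\<phi> in auto)
  ultimately have "deriv F 0 * deriv \<phi> 0 = 1" by (rule DERIV_unique)
  then have prod: "norm (deriv F 0) * norm (deriv \<phi> 0) = 1" by (metis norm_mult norm_one)
  have "norm (deriv F 0) \<le> b" using F_ball F0 by (intro deriv_le hF) auto
  then have "1 \<le> b * norm (deriv \<phi> 0)"
    using prod mult_right_mono[of "norm (deriv F 0)" b "norm (deriv \<phi> 0)"] by simp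
  then have far: "1 / (4 * b) \<le> norm w" if "w \<notin> \<Omega>" for w
  proof -
    have "norm (deriv \<phi> 0) \<le> 4 * norm w"
    proof (rule koebe_quarter[OF h\<phi> inj \<phi>0])
      show "w \<notin> \<phi> ` ball 0 1" using \<phi>_mem that by blast
    qed
    then have "b * norm (deriv \<phi> 0) \<le> b * (4 * norm w)" using b by (intro mult_left_mono) auto
    with \<open>1 \<le> b * norm (deriv \<phi> 0)\<close> have "1 \<le> b * (4 * norm w)" by linarith
    then show ?thesis using b by (simp add: field_simps)
  qed
  show ?thesis
  proof
    fix w :: complex assume "w \<in> ball 0 (1 / (4 * b))"
    then have "\<not> 1 / (4 * b) \<le> norm w" by simp
    then show "w \<in> \<Omega>" using far by blast
  qed
qed simp

section \<open>Coefficients of functions of the Schur class\<close>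

text \<open>For nonconstant \<open>f\<close> this unfolds the supremum, which is an upper bound
  thanks to \<open>bdd\<close>. Constant functions lie outside \<open>bohr_lambda_set\<close>, but
  their coefficients vanish for \<open>n \<ge> 1\<close>.\<close>

lemma schur_class_coeff_le:
  assumes bdd: "bdd_above (bohr_lambda_set \<Omega>)" and pos: "bohr_lambda \<Omega> > 0"
    and \<Omega>: "ball 0 1 \<subseteq> \<Omega>" and f: "f \<in> schur_class \<Omega>" and n: "n \<ge> 1"
  shows "norm (taylor_coeff f n) \<le> bohr_lambda \<Omega> * (1 - norm (f 0) ^ 2)"
proof -
  have "0 \<in> \<Omega>" using \<Omega> by auto
  then have lt1: "norm (f 0) < 1" using f by (auto simp: schur_class_def)
  then have pos1: "1 - norm (f 0) ^ 2 > 0" by (simp add: abs_square_less_1)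
  show ?thesis
  proof (cases "\<exists>c. \<forall>z\<in>\<Omega>. f z = c")
    case True
    then obtain c where "\<And>z. z \<in> ball 0 1 \<Longrightarrow> f z = c" using \<Omega> by blast
    then have "taylor_coeff f n = taylor_coeff (\<lambda>z. c) n"
      by (intro taylor_coeff_cong[of "ball 0 1"]) auto
    then show ?thesis using n pos pos1 by simp
  next
    case False
    then have "norm (taylor_coeff f n) / (1 - norm (taylor_coeff f 0) ^ 2) \<in> bohr_lambda_set \<Omega>"
      using f n unfolding bohr_lambda_set_def by blast
    then have "norm (taylor_coeff f n) / (1 - norm (f 0) ^ 2) \<le> bohr_lambda \<Omega>"
      unfolding bohr_lambda_def using bdd by (auto intro: cSup_upper)
    then show ?thesis using pos1 by (simp add: field_simps)
  qed
qed

lemma schur_class_moebius: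
  assumes f: "f \<in> schur_class \<Omega>" and t: "norm t < 1"
  shows "(\<lambda>z. (f z + cnj t) / (1 + t * f z)) \<in> schur_class \<Omega>"
  using f disc_moebius_norm(1,2)[OF _ t] unfolding schur_class_def
  by (auto intro!: holomorphic_intros)

text \<open>The geometric series in powers of \<open>s * h\<close>: as \<open>h\<close> vanishes at
  0, powers of \<open>h\<close> beyond the \<open>n\<close>-th do not reach the coefficient
  \<open>n\<close>. The result is a polynomial in \<open>s\<close>, which later makes the
  coefficient holomorphic in the automorphism parameter.\<close>

lemma taylor_coeff_linear_fractional:
  assumes holo: "h holomorphic_on ball 0 1" and h0: "h 0 = 0"
    and nz: "\<And>z. norm z < 1 \<Longrightarrow> 1 + s * h z \<noteq> 0"
  shows "taylor_coeff (\<lambda>z. h z / (1 + s * h z)) n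
    = (\<Sum>k<n. (- s) ^ k * fps_nth (Abs_fps (taylor_coeff h) ^ Suc k) n)"
proof -
  define H where "H = Abs_fps (taylor_coeff h)"
  have H: "h has_fps_expansion H"
    unfolding H_def using taylor_coeff_expansion[OF holo] by simp
  have H0: "fps_nth H 0 = 0" by (simp add: H_def h0)
  define W where "W = inverse (1 + fps_const s * H)"
  have hpow: "(\<lambda>z. h z ^ k) has_fps_expansion H ^ k" for k
    by (induction k) (auto intro!: has_fps_expansion_mult H)
  \<comment> \<open>The series is cut after \<open>n\<close> terms with its exact remainder. The
    remainder carries the factor \<open>h z ^ Suc n\<close> and so contributes nothing at index
    \<open>n\<close>.\<close>
  have "(\<lambda>z. (\<Sum>k<n. (- s) ^ k * h z ^ Suc k) + (- s) ^ n * (h z ^ Suc n * inverse (1 + s * h z)))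
    has_fps_expansion (\<Sum>k<n. fps_const ((- s) ^ k) * H ^ Suc k) + fps_const ((- s) ^ n) * (H ^ Suc n * W)"
    unfolding W_def using H0
    by (intro has_fps_expansion_add has_fps_expansion_sum has_fps_expansion_cmult_left has_fps_expansion_mult
        has_fps_expansion_inverse has_fps_expansion_1 hpow H) auto
  from taylor_coeff_eq_fps_nth[OF this, of n]
  have "taylor_coeff (\<lambda>z. (\<Sum>k<n. (- s) ^ k * h z ^ Suc k) + (- s) ^ n * (h z ^ Suc n * inverse (1 + s * h z))) n
    = (\<Sum>k<n. (- s) ^ k * fps_nth (H ^ Suc k) n) + (- s) ^ n * fps_nth (H ^ Suc n * W) n"
    by (simp add: fps_sum_nth)
  also have "fps_nth (H ^ Suc n * W) n = (\<Sum>i=0..n. fps_nth (H ^ Suc n) i * fps_nth W (n - i))"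
    by (simp only: fps_mult_nth)
  also have "\<dots> = 0"
    using startsby_zero_power_prefix[OF H0, of "Suc n"] by (intro sum.neutral) auto
  also have "taylor_coeff (\<lambda>z. (\<Sum>k<n. (- s) ^ k * h z ^ Suc k) + (- s) ^ n * (h z ^ Suc n * inverse (1 + s * h z))) n
    = taylor_coeff (\<lambda>z. h z / (1 + s * h z)) n"
  proof (rule taylor_coeff_cong[of "ball 0 1"])
    fix z :: complex assume "z \<in> ball 0 1"
    then have nz': "1 + s * h z \<noteq> 0" using nz by simp
    have "(\<Sum>k<n. (- s) ^ k * h z ^ Suc k) = h z * (\<Sum>k<n. (- (s * h z)) ^ k)"
      by (simp add: sum_distrib_left power_mult_distrib[symmetric] mult_ac)
    also have "(\<Sum>k<n. (- (s * h z)) ^ k) = (1 - (- (s * h z)) ^ n) / (1 + s * h z)"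
    proof -
      have "- (s * h z) \<noteq> 1"
      proof
        assume "- (s * h z) = 1"
        then have "s * h z = - 1" by (metis minus_minus)
        then show False using nz' by simp
      qed
      then show ?thesis by (simp add: sum_gp_strict)
    qed
    finally show "(\<Sum>k<n. (- s) ^ k * h z ^ Suc k) + (- s) ^ n * (h z ^ Suc n * inverse (1 + s * h z)) = h z / (1 + s * h z)"
      using nz' by (simp add: field_simps power_mult_distrib[symmetric])
  qed auto
  finally show ?thesis by (simp add: H_def)
qed

text \<open>A first-order variation: \<open>schur_class_coeff_le\<close> holds for every disc
  automorphism composed with \<open>f\<close>, and the resulting bounded holomorphic
  \<open>p\<close> cannot have both a large value and a large derivative at
  \<open>t = 0\<close>.\<close>

lemma schur_class_coeff_improved:
  assumes bdd: "bdd_above (bohr_lambda_set \<Omega>)" and pos: "bohr_lambda \<Omega> > 0"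
    and \<Omega>: "ball 0 1 \<subseteq> \<Omega>" and f: "f \<in> schur_class \<Omega>" and n: "n \<ge> 1"
  shows "norm (taylor_coeff f n) + norm (taylor_coeff (\<lambda>z. (f z - f 0) ^ 2) n) / 2
    \<le> bohr_lambda \<Omega> * (1 - norm (f 0) ^ 2)"
proof -
  define a where "a = f 0"
  define L where "L = bohr_lambda \<Omega> * (1 - norm a ^ 2)"
  define h where "h z = f z - a" for z
  define H where "H = Abs_fps (taylor_coeff h)"
  have lt1: "norm (f z) < 1" if "norm z < 1" for z
    using f that \<Omega> by (auto simp: schur_class_def)
  then have a1: "norm a < 1" by (simp add: a_def)
  then have a2: "1 - norm a ^ 2 > 0" by (simp add: abs_square_less_1)
  then have L0: "L > 0" using pos by (simp add: L_def)
  have hf: "f holomorphic_on ball 0 1"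
    using f \<Omega> by (auto simp: schur_class_def intro: holomorphic_on_subset)
  have hh: "h holomorphic_on ball 0 1" unfolding h_def by (intro holomorphic_intros hf)
  have h0: "h 0 = 0" by (simp add: h_def a_def)
  have Hn: "taylor_coeff f n = fps_nth H n"
    using taylor_coeff_diff_const[OF hf zero_less_one n, of a] by (simp add: H_def h_def[abs_def])
  have H2: "taylor_coeff (\<lambda>z. (f z - f 0) ^ 2) n = fps_nth (H ^ 2) n"
  proof -
    have "h has_fps_expansion H" unfolding H_def using taylor_coeff_expansion[OF hh] by simp
    then have "(\<lambda>z. h z * h z) has_fps_expansion H * H" by (intro has_fps_expansion_mult)
    from taylor_coeff_eq_fps_nth[OF this] show ?thesis
      by (simp add: h_def a_def power2_eq_square)
  qed
  \<comment> \<open>Up to a factor \<open>c\<close> independent of \<open>z\<close>, this is the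
    \<open>n\<close>-th coefficient of the composition with parameter \<open>t\<close>, expanded
    with \<open>s = t / (1 + t * a)\<close>. All dependence on \<open>cnj t\<close> sits in
    \<open>c\<close>, so \<open>p\<close> is holomorphic.\<close>
  define p where "p t = (\<Sum>k<n. (- (t / (1 + t * a))) ^ k * fps_nth (H ^ Suc k) n)" for t
  have ta: "1 + t * a \<noteq> 0" if "norm t < 1" for t
    using disc_moebius_norm(1)[OF a1 that] .
  have hp: "p holomorphic_on ball 0 1"
    unfolding p_def using ta by (intro holomorphic_intros) auto
  have p_bound: "norm (p t) \<le> L" if t: "norm t < 1" for t
  proof -
    define s where "s = t / (1 + t * a)"
    have tf: "1 + t * f z \<noteq> 0" if "norm z < 1" for z
      using disc_moebius_norm(1)[OF lt1[OF that] t] .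
    have s1: "1 + s * h z = (1 + t * f z) / (1 + t * a)" for z
      using ta[OF t] by (simp add: s_def h_def field_simps)
    have nz: "1 + s * h z \<noteq> 0" if "norm z < 1" for z
      using tf[OF that] ta[OF t] by (simp add: s1)
    \<comment> \<open>\<open>|c|\<close> is also the ratio of \<open>1 - |F 0|^2\<close> to
      \<open>1 - |a|^2\<close>, so it cancels from the coefficient bound and leaves
      \<open>norm (p t) \<le> L\<close>.\<close>
    define c where "c = of_real (1 - norm t ^ 2) / (1 + t * a) ^ 2"
    define F where "F z = (f z + cnj t) / (1 + t * f z)" for z
    have F: "F \<in> schur_class \<Omega>"
      unfolding F_def by (rule schur_class_moebius[OF f t])
    have hF: "F holomorphic_on ball 0 1"
      using F \<Omega> by (auto simp: schur_class_def intro: holomorphic_on_subset)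
    have "taylor_coeff F n = taylor_coeff (\<lambda>z. F z - F 0) n"
      using taylor_coeff_diff_const[OF hF zero_less_one n] by simp
    also have "\<dots> = taylor_coeff (\<lambda>z. c * (h z / (1 + s * h z))) n"
    proof (rule taylor_coeff_cong[of "ball 0 1"])
      fix z :: complex assume "z \<in> ball 0 1"
      then have z: "norm z < 1" by simp
      have "F z - F 0 = (1 - t * cnj t) * h z / ((1 + t * f z) * (1 + t * a))"
        using tf[OF z] ta[OF t] unfolding F_def h_def a_def[symmetric] by (simp add: field_simps)
      also have "\<dots> = c * (h z / (1 + s * h z))"
        using tf[OF z] ta[OF t] by (simp add: s1 c_def complex_norm_square power2_eq_square[of "1 + t * a"] del: of_real_power)
      finally show "F z - F 0 = c * (h z / (1 + s * h z))" .
    qed auto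
    also have "\<dots> = c * taylor_coeff (\<lambda>z. h z / (1 + s * h z)) n"
      using nz by (intro taylor_coeff_const_mult[of _ 1] holomorphic_intros hh) auto
    also have "taylor_coeff (\<lambda>z. h z / (1 + s * h z)) n = p t"
      using taylor_coeff_linear_fractional[OF hh h0 nz] by (simp add: p_def s_def H_def)
    finally have "norm (taylor_coeff F n) = norm c * norm (p t)" by (simp add: norm_mult)
    moreover have "norm (taylor_coeff F n) \<le> bohr_lambda \<Omega> * (1 - norm (F 0) ^ 2)"
      by (rule schur_class_coeff_le[OF bdd pos \<Omega> F n])
    moreover have "1 - norm (F 0) ^ 2 = norm c * (1 - norm a ^ 2)"
    proof -
      have "1 - norm (F 0) ^ 2 = (1 - norm t ^ 2) * (1 - norm a ^ 2) / norm (1 + t * a) ^ 2"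
        using disc_moebius_norm(3)[OF a1 t] by (simp add: F_def a_def)
      moreover have "norm c = (1 - norm t ^ 2) / norm (1 + t * a) ^ 2"
        using t by (simp add: c_def norm_divide norm_power abs_square_le_1 del: of_real_diff of_real_power)
      ultimately show ?thesis by simp
    qed
    moreover have "norm c > 0"
    proof -
      have "1 - norm t ^ 2 \<noteq> 0" using t abs_square_less_1[of "norm t"] by simp
      then show ?thesis unfolding zero_less_norm_iff c_def
        using ta[OF t] by (simp only: divide_eq_0_iff of_real_eq_0_iff power_eq_0_iff) simp
    qed
    ultimately show ?thesis by (simp add: L_def)
  qed
  have p0: "p 0 = fps_nth H n"
  proof -
    have "p 0 = (\<Sum>k<n. if k = 0 then fps_nth H n else 0)"
      unfolding p_def by (intro sum.cong) (auto simp: power_0_left)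
    then show ?thesis using n by simp
  qed
  have p1: "taylor_coeff p 1 = - fps_nth (H ^ 2) n"
  proof -
    have "(p has_field_derivative (\<Sum>k<n. of_nat k * (0 ^ (k - 1) * - 1) * fps_nth (H ^ Suc k) n)) (at 0)"
      unfolding p_def by (auto intro!: derivative_eq_intros sum.cong simp: mult_ac)
    then have "taylor_coeff p 1 = (\<Sum>k<n. of_nat k * (0 ^ (k - 1) * - 1) * fps_nth (H ^ Suc k) n)"
      by (simp add: taylor_coeff_def DERIV_imp_deriv)
    also have "\<dots> = (\<Sum>k<n. if k = 1 then - fps_nth (H ^ 2) n else 0)"
      by (intro sum.cong) (auto simp: power_0_left eval_nat_numeral)
    \<comment> \<open>For \<open>n = 1\<close> the sum has no term \<open>k = 1\<close>, but then
      \<open>H ^ 2\<close> has no linear coefficient either.\<close>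
    also have "\<dots> = - fps_nth (H ^ 2) n"
      using startsby_zero_power_prefix[of H 2] n h0
      by (cases "n = 1") (auto simp: H_def)
    finally show ?thesis .
  qed
  \<comment> \<open>Schwarz--Pick for \<open>p / L\<close> at 0. With \<open>y = |p 0| / L\<close>,
    the estimate \<open>1 - y^2 \<le> 2 - 2 * y\<close> then makes it linear.\<close>
  have "norm (taylor_coeff (\<lambda>t. of_real (1 / L) * p t) 1) \<le> 1 - norm (of_real (1 / L) * p 0) ^ 2"
    by (rule schur_coeff_bound) (use L0 p_bound in \<open>auto intro!: holomorphic_intros hp simp: norm_mult field_simps norm_divide\<close>)
  then have "norm (fps_nth (H ^ 2) n) / L \<le> 1 - (norm (fps_nth H n) / L) ^ 2"
    using L0 unfolding taylor_coeff_const_mult[OF hp zero_less_one] p0 p1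
    by (simp add: norm_mult norm_divide)
  also have "\<dots> \<le> 2 - 2 * (norm (fps_nth H n) / L)"
    using zero_le_power2[of "1 - norm (fps_nth H n) / L"] by (simp add: power2_diff)
  finally have "norm (fps_nth H n) + norm (fps_nth (H ^ 2) n) / 2 \<le> L"
    using L0 by (simp add: field_simps)
  then show ?thesis by (simp add: Hn H2 L_def a_def)
qed

section \<open>Bohr's inequality\<close>

text \<open>\<open>A\<close> is \<open>|a\<^sub>0|\<close>; \<open>S\<close> and \<open>Q\<close>
  are the linear and quadratic sums from \<open>n = 1\<close> at the critical radius. As
  \<open>A + (1 - A\<^sup>2) / 2 + (1 - A)\<^sup>2 / 2 = 1\<close>, the net contribution of
  \<open>Q\<close> must stay below \<open>(1 - A)\<^sup>2 / 2\<close>. This reduces to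
  \<open>u / 2 + u\<^sup>2 * (1 / 3 - p / 2) < 2\<close>, where \<open>p \<ge> 1 / 6\<close> (that
  is, \<open>lam \<ge> 1 / 5\<close>) and \<open>u < 2\<close> keep each summand below 1.\<close>

lemma bohr_inequality_large_lambda:
  fixes A lam S Q :: real
  assumes A: "0 \<le> A" "A < 1" and lam: "lam \<ge> 1 / 5"
    and S: "S \<le> (1 - A\<^sup>2) / 2 - Q / 2"
    and Q: "Q \<le> lam * (1 - A\<^sup>2)\<^sup>2 / (4 * (1 + lam))"
  shows "A + S + ((1 + lam) / (2 * lam * (1 + A)) + (1 + lam) / (3 * lam)) * Q < 1"
proof -
  define p u where "p = lam / (1 + lam)" and "u = 1 + A"
  have p: "p \<ge> 1 / 6" "p < 1" and u: "1 \<le> u" "u < 2"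
    using lam A by (auto simp: p_def u_def field_simps)
  have C: "(1 + lam) / (2 * lam * (1 + A)) + (1 + lam) / (3 * lam) = 1 / (2 * p * u) + 1 / (3 * p)"
    using lam A by (simp add: p_def u_def)
  have Q': "Q \<le> p * ((1 - A)\<^sup>2 * u\<^sup>2 / 4)"
  proof -
    have "(1 - A\<^sup>2)\<^sup>2 = (1 - A)\<^sup>2 * u\<^sup>2"
      unfolding u_def by (simp add: power_mult_distrib[symmetric] power2_eq_square algebra_simps)
    moreover have "lam * x / (4 * (1 + lam)) = lam / (1 + lam) * (x / 4)" for x by simp
    ultimately show ?thesis using Q by (simp only: p_def)
  qed
  \<comment> \<open>The factor of \<open>Q\<close>, after subtracting the gain \<open>1 / 2\<close>,
    must be nonnegative before the upper bound on \<open>Q\<close> is inserted; it is at least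
    \<open>1 / 4 + 1 / 3 - 1 / 2\<close>.\<close>
  have "1 / (2 * p * u) \<ge> 1 / (2 * 1 * 2)" using p u by (intro divide_left_mono mult_mono) auto
  moreover have "1 / (3 * p) \<ge> 1 / 3" using p by (simp add: field_simps)
  ultimately have "(1 / (2 * p * u) + 1 / (3 * p) - 1 / 2) * Q
      \<le> (1 / (2 * p * u) + 1 / (3 * p) - 1 / 2) * (p * ((1 - A)\<^sup>2 * u\<^sup>2 / 4))"
    by (intro mult_left_mono Q') simp
  also have "\<dots> = (1 - A)\<^sup>2 / 4 * (u / 2 + u\<^sup>2 * (1 / 3 - p / 2))"
    using p u by (simp add: field_simps power2_eq_square)
  also have "\<dots> < (1 - A)\<^sup>2 / 4 * 2"
  proof (rule mult_strict_left_mono)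
    have "u\<^sup>2 * (1 / 3 - p / 2) \<le> u\<^sup>2 * (1 / 4)" using p by (intro mult_left_mono) auto
    moreover have "u\<^sup>2 < 2\<^sup>2" using u by (intro power_strict_mono) auto
    then have "u\<^sup>2 * (1 / 4) < 1" by simp
    ultimately show "u / 2 + u\<^sup>2 * (1 / 3 - p / 2) < 2" using u by linarith
  qed (use A in simp)
  finally have "(1 / (2 * p * u) + 1 / (3 * p) - 1 / 2) * Q < (1 - A)\<^sup>2 / 2" by simp
  moreover have "A + ((1 - A\<^sup>2) / 2) + (1 - A)\<^sup>2 / 2 = 1"
    by (simp add: power2_eq_square field_simps)
  ultimately show ?thesis unfolding C using S by (simp only: left_diff_distrib)
qed

text \<open>Inserting the bound on \<open>Q\<close> makes its contribution independent of
  \<open>lam\<close>. Only for \<open>A\<close> near 1, where \<open>u / 8 + u\<^sup>2 / 12\<close>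
  exceeds \<open>1 / 2\<close>, is the gain \<open>1 / 100\<close> essential: it contributes to
  first order in \<open>1 - A\<close>, the loss only to second order.\<close>

lemma bohr_inequality_small_lambda:
  fixes A lam S Q :: real
  assumes A: "0 \<le> A" "A < 1" and lam: "lam > 0"
    and S: "S \<le> (1 - A\<^sup>2) * (1 / 2 - 1 / 100)"
    and Q: "Q \<le> lam * (1 - A\<^sup>2)\<^sup>2 / (4 * (1 + lam))"
  shows "A + S + ((1 + lam) / (2 * lam * (1 + A)) + (1 + lam) / (3 * lam)) * Q < 1"
proof -
  define u where "u = 1 + A"
  have u: "1 \<le> u" "u < 2" using A by (auto simp: u_def)
  have "((1 + lam) / (2 * lam * (1 + A)) + (1 + lam) / (3 * lam)) * Q
    \<le> ((1 + lam) / (2 * lam * (1 + A)) + (1 + lam) / (3 * lam)) * (lam * (1 - A\<^sup>2)\<^sup>2 / (4 * (1 + lam)))"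
    using lam A by (intro mult_left_mono Q) auto
  also have "1 - A\<^sup>2 = (2 - u) * u" by (simp add: u_def power2_eq_square algebra_simps)
  also have "((1 + lam) / (2 * lam * (1 + A)) + (1 + lam) / (3 * lam)) * (lam * ((2 - u) * u)\<^sup>2 / (4 * (1 + lam)))
    = (2 - u)\<^sup>2 * (u / 8 + u\<^sup>2 / 12)"
  proof -
    have "(1 + lam) / (2 * lam * u) * (lam * ((2 - u) * u)\<^sup>2 / (4 * (1 + lam))) = (2 - u)\<^sup>2 * (u / 8)"
      using lam u by (simp add: divide_simps power2_eq_square)
    moreover have "(1 + lam) / (3 * lam) * (lam * ((2 - u) * u)\<^sup>2 / (4 * (1 + lam))) = (2 - u)\<^sup>2 * (u\<^sup>2 / 12)"
      using lam by (simp add: divide_simps power2_eq_square)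
    ultimately show ?thesis by (simp only: u_def[symmetric] distrib_right distrib_left)
  qed
  finally have q: "((1 + lam) / (2 * lam * (1 + A)) + (1 + lam) / (3 * lam)) * Q \<le> (2 - u)\<^sup>2 * (u / 8 + u\<^sup>2 / 12)" .
  \<comment> \<open>Up to \<open>9 / 5\<close> the bracket is nonpositive. Beyond, it is at most
    \<open>1 / 12\<close> while \<open>2 - u < 1 / 5\<close>, and
    \<open>1 / 60 < 9 / 500\<close>.\<close>
  have key: "(2 - u) * (u / 8 + u\<^sup>2 / 12 - 1 / 2) < u / 100"
  proof (cases "u \<le> 9 / 5")
    case True
    then have "u\<^sup>2 \<le> (9 / 5)\<^sup>2" using u by (intro power_mono) auto
    then have "u / 8 + u\<^sup>2 / 12 - 1 / 2 \<le> 0" using True by (simp add: power2_eq_square)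
    then have "(2 - u) * (u / 8 + u\<^sup>2 / 12 - 1 / 2) \<le> 0" using u by (simp add: mult_nonneg_nonpos)
    then show ?thesis using u by linarith
  next
    case False
    have "u\<^sup>2 \<le> 2\<^sup>2" using u by (intro power_mono) auto
    then have "u / 8 + u\<^sup>2 / 12 - 1 / 2 \<le> 1 / 12" using u by simp
    then have "(2 - u) * (u / 8 + u\<^sup>2 / 12 - 1 / 2) \<le> (2 - u) * (1 / 12)"
      using u by (intro mult_left_mono) auto
    then show ?thesis using False by simp
  qed
  have "A + S + (2 - u)\<^sup>2 * (u / 8 + u\<^sup>2 / 12)
    \<le> A + (2 - u) * u * (1 / 2 - 1 / 100) + (2 - u)\<^sup>2 * (u / 8 + u\<^sup>2 / 12)"
    using S by (simp add: u_def power2_eq_square algebra_simps)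
  also have "\<dots> = 1 + (2 - u) * ((2 - u) * (u / 8 + u\<^sup>2 / 12 - 1 / 2) - u / 100)"
    by (simp add: u_def field_simps power2_eq_square)
  also have "\<dots> < 1"
    using key u by (simp add: mult_pos_neg)
  finally show ?thesis using q by linarith
qed

text \<open>The flat bound \<open>L\<close> on all coefficients would give exactly
  \<open>1 / 2\<close>. Stopping it after seven terms saves \<open>R ^ 7 / 2\<close>, while the
  geometric tail costs \<open>R ^ 7\<close> times \<open>(4 * lam) ^ 8 / (1 - 2 * lam)\<close>,
  which is below \<open>28 / 100\<close> for \<open>lam \<le> 1 / 5\<close>.\<close>

lemma small_lambda_numeric:
  fixes lam :: real
  assumes lam: "0 < lam" "lam \<le> 1 / 5"
  defines "R \<equiv> 1 / (1 + 2 * lam)"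
  shows "4 * lam * R < 1"
    and "(\<Sum>n<7. lam * R ^ Suc n) + (4 * lam * R) ^ 8 / (1 - 4 * lam * R) \<le> 1 / 2 - 1 / 100"
proof -
  have R: "0 < R" "R < 1" using lam by (auto simp: R_def)
  have R1: "1 - 4 * lam * R = (1 - 2 * lam) * R" "1 - R = 2 * lam * R"
    using lam by (auto simp: R_def field_simps)
  have "0 < (1 - 2 * lam) * R" using R lam by (intro mult_pos_pos) auto
  then show "4 * lam * R < 1" unfolding R1(1)[symmetric] by simp
  have "(\<Sum>n<7. lam * R ^ Suc n) = lam * R * (\<Sum>n<7. R ^ n)"
    by (simp add: sum_distrib_left mult_ac)
  also have "\<dots> = lam * R * ((1 - R ^ 7) / (1 - R))"
    using R by (subst sum_gp_strict) auto
  also have "\<dots> = 1 / 2 - R ^ 7 / 2"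
    unfolding R1 using R lam by (simp add: field_simps)
  finally have head: "(\<Sum>n<7. lam * R ^ Suc n) = 1 / 2 - R ^ 7 / 2" .
  have tail: "(4 * lam * R) ^ 8 / (1 - 4 * lam * R) = R ^ 7 * ((4 * lam) ^ 8 / (1 - 2 * lam))"
    unfolding R1 power_mult_distrib using R by (simp add: eval_nat_numeral)
  have "(\<Sum>n<7. lam * R ^ Suc n) + (4 * lam * R) ^ 8 / (1 - 4 * lam * R)
    = 1 / 2 - R ^ 7 * (1 / 2 - (4 * lam) ^ 8 / (1 - 2 * lam))"
    unfolding head tail by (simp add: algebra_simps)
  also have "\<dots> \<le> 1 / 2 - 1 / 100"
  proof -
    have "(4 * lam) ^ 8 / (1 - 2 * lam) \<le> (4 / 5) ^ 8 / (3 / 5)"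
      using lam by (intro frac_le power_mono) auto
    then have b: "1 / 2 - (4 * lam) ^ 8 / (1 - 2 * lam) \<ge> 22 / 100"
      by (simp add: eval_nat_numeral)
    have "5 / 7 \<le> R" using lam by (simp add: R_def field_simps)
    then have "(5 / 7) ^ 7 \<le> R ^ 7" by (intro power_mono) auto
    then have "R ^ 7 \<ge> 5 / 100" by (simp add: eval_nat_numeral)
    then have "5 / 100 * (22 / 100) \<le> R ^ 7 * (1 / 2 - (4 * lam) ^ 8 / (1 - 2 * lam))"
      using b R by (intro mult_mono) auto
    then show ?thesis by linarith
  qed
  finally show "(\<Sum>n<7. lam * R ^ Suc n) + (4 * lam * R) ^ 8 / (1 - 4 * lam * R) \<le> 1 / 2 - 1 / 100" .
qed

text \<open>Both sides are compared through a bound for \<open>|h|^2\<close> on the circle of radius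
  \<open>r\<close>: the series of \<open>h^2\<close> gives \<open>|h|^2 \<le> Y\<close> there, and
  Parseval passes this to the left side.\<close>

lemma sum_norm_square_le_square_coeffs:
  assumes holo: "h holomorphic_on ball 0 1" and r: "0 \<le> r" "r < 1"
  shows "(\<Sum>n<N. norm (taylor_coeff h n) ^ 2 * r ^ (2 * n)) \<le> (\<Sum>n. norm (taylor_coeff (\<lambda>z. h z ^ 2) n) * r ^ n)"
proof -
  define Y where "Y = (\<Sum>n. norm (taylor_coeff (\<lambda>z. h z ^ 2) n) * r ^ n)"
  have h2: "(\<lambda>z. h z ^ 2) holomorphic_on ball 0 1" by (intro holomorphic_intros holo)
  have sm: "summable (\<lambda>n. norm (taylor_coeff (\<lambda>z. h z ^ 2) n) * r ^ n)"
    by (rule taylor_coeff_abs_summable[OF h2 r])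
  have Y0: "Y \<ge> 0" unfolding Y_def by (intro suminf_nonneg sm) (use r in auto)
  have "norm (h z) \<le> sqrt Y" if z: "norm z = r" for z
  proof -
    have s: "(\<lambda>n. taylor_coeff (\<lambda>z. h z ^ 2) n * z ^ n) sums (h z ^ 2)"
      by (rule taylor_coeff_sums[OF h2]) (use z r in simp)
    have "norm (h z ^ 2) \<le> Y"
      unfolding Y_def sums_unique[OF s]
      using summable_norm[of "\<lambda>n. taylor_coeff (\<lambda>z. h z ^ 2) n * z ^ n"] sm z
      by (simp add: norm_mult norm_power)
    then show ?thesis by (intro real_le_rsqrt) (simp add: norm_power)
  qed
  from sum_norm_square_le_of_circle_bound[OF holo r this, of N] Y0
  show ?thesis by (simp add: Y_def)
qed

text \<open>\<open>ball_subset_simply_connected\<close> supplies a disc of radius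
  \<open>\<rho> = 1 / (4 * lam)\<close> inside \<open>\<Omega>\<close>, its derivative hypothesis
  being the case \<open>n = 1\<close> of \<open>schur_class_coeff_le\<close>. Rescaling that disc to
  the unit disc multiplies the \<open>n\<close>-th coefficient by \<open>\<rho> ^ n\<close>.\<close>

lemma schur_class_coeff_decay:
  assumes op: "open \<Omega>" and sc: "simply_connected \<Omega>"
    and bdd: "bdd_above (bohr_lambda_set \<Omega>)" and pos: "bohr_lambda \<Omega> > 0"
    and \<Omega>: "ball 0 1 \<subseteq> \<Omega>" and f: "f \<in> schur_class \<Omega>" and n: "n \<ge> 1"
  shows "norm (taylor_coeff f n) \<le> (1 - norm (f 0) ^ 2) * (4 * bohr_lambda \<Omega>) ^ n"
proof -
  define lam where "lam = bohr_lambda \<Omega>"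
  define \<rho> where "\<rho> = 1 / (4 * lam)"
  have \<rho>: "\<rho> > 0" using pos by (simp add: \<rho>_def lam_def)
  have "ball 0 (1 / (4 * lam)) \<subseteq> \<Omega>"
  proof (rule ball_subset_simply_connected[OF op sc])
    fix g assume "g holomorphic_on \<Omega>" "\<And>z. z \<in> \<Omega> \<Longrightarrow> norm (g z) < 1" "g 0 = 0"
    then show "norm (deriv g 0) \<le> lam"
      using schur_class_coeff_le[OF bdd pos \<Omega>, of g 1]
      by (auto simp: schur_class_def taylor_coeff_def lam_def)
  qed (use pos \<Omega> in \<open>auto simp: lam_def\<close>)
  then have sub: "ball 0 \<rho> \<subseteq> \<Omega>" by (simp add: \<rho>_def)
  then have hf: "f holomorphic_on ball 0 \<rho>"
    using f by (auto simp: schur_class_def intro: holomorphic_on_subset)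
  have mem: "of_real \<rho> * z \<in> ball 0 \<rho>" if "norm z < 1" for z :: complex
    using that \<rho> by (simp add: norm_mult)
  define u where "u z = f (of_real \<rho> * z)" for z
  have hu: "u holomorphic_on ball 0 1"
    unfolding u_def
    by (rule holomorphic_on_compose_gen[OF _ hf, unfolded o_def]) (use mem in \<open>auto intro!: holomorphic_intros\<close>)
  have "norm (u z) < 1" if "norm z < 1" for z
    using mem[OF that] sub f by (auto simp: u_def schur_class_def)
  then have "norm (taylor_coeff u n) \<le> 1 - norm (u 0) ^ 2"
    by (intro schur_coeff_bound_strict[OF hu _ n])
  moreover have "taylor_coeff u n = of_real \<rho> ^ n * taylor_coeff f n"
    using higher_deriv_compose_linear[OF hf, of "ball 0 1" 0 "of_real \<rho>" n] mem
    by (auto simp: taylor_coeff_def u_def[abs_def])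
  ultimately have "\<rho> ^ n * norm (taylor_coeff f n) \<le> 1 - norm (f 0) ^ 2"
    using \<rho> by (simp add: norm_mult norm_power u_def)
  then show ?thesis
    using pos by (simp add: \<rho>_def lam_def[symmetric] power_divide field_simps)
qed

lemma bohr_inequality_at_radius:
  assumes op: "open \<Omega>" and sc: "simply_connected \<Omega>"
    and bdd: "bdd_above (bohr_lambda_set \<Omega>)" and pos: "bohr_lambda \<Omega> > 0"
    and \<Omega>: "ball 0 1 \<subseteq> \<Omega>" and f: "f \<in> schur_class \<Omega>"
  defines "lam \<equiv> bohr_lambda \<Omega>"
  defines "a \<equiv> taylor_coeff f"
  defines "R \<equiv> 1 / (1 + 2 * lam)"
  shows "(\<Sum>n. norm (a n) * R ^ n)
    + ((1 + lam) / (2 * lam * (1 + norm (a 0))) + 2 / 3 * ((1 + lam) * R / (1 - R)))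
      * (\<Sum>n. norm (a (Suc n)) ^ 2 * R ^ (2 * Suc n)) < 1"
proof -
  define A where "A = norm (f 0)"
  define L where "L = lam * (1 - A\<^sup>2)"
  have lam: "lam > 0" using pos by (simp add: lam_def)
  have R: "0 < R" "R < 1" using lam by (auto simp: R_def)
  have R1: "R / (1 - R) = 1 / (2 * lam)" using lam by (simp add: R_def field_simps)
  have hf: "f holomorphic_on ball 0 1"
    using f \<Omega> by (auto simp: schur_class_def intro: holomorphic_on_subset)
  have "0 \<in> \<Omega>" using \<Omega> by auto
  then have A: "0 \<le> A" "A < 1" using f by (auto simp: A_def schur_class_def)
  then have A2: "1 - A\<^sup>2 > 0" by (simp add: abs_square_less_1)
  have cL: "norm (a n) \<le> L" if "n \<ge> 1" for n
    using schur_class_coeff_le[OF bdd pos \<Omega> f that] by (simp add: a_def L_def A_def lam_def)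
  have sm: "summable (\<lambda>n. norm (a n) * R ^ n)"
    unfolding a_def using R by (intro taylor_coeff_abs_summable[OF hf]) auto
  define S where "S = (\<Sum>n. norm (a (Suc n)) * R ^ Suc n)"
  define Q where "Q = (\<Sum>n. norm (a (Suc n)) ^ 2 * R ^ (2 * Suc n))"
  have smS: "summable (\<lambda>n. norm (a (Suc n)) * R ^ Suc n)"
    using sm by (subst summable_Suc_iff)
  have split: "(\<Sum>n. norm (a n) * R ^ n) = A + S"
    using suminf_split_head[OF sm] by (simp add: S_def a_def A_def)
  have geo: "(\<lambda>n. R ^ Suc n) sums (R / (1 - R))"
    using sums_mult[OF geometric_sums[of R], of R] R by simp
  have R2: "R\<^sup>2 < 1" using R by (simp add: abs_square_less_1)
  have "R ^ (2 * Suc n) = R\<^sup>2 * (R\<^sup>2) ^ n" for n by (simp only: power_mult power_Suc)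
  then have geo2: "(\<lambda>n. L\<^sup>2 * R ^ (2 * Suc n)) sums (L\<^sup>2 * (R\<^sup>2 / (1 - R\<^sup>2)))"
    using sums_mult[OF geometric_sums[of "R\<^sup>2"], of "L\<^sup>2 * R\<^sup>2"] R2
    by (simp add: mult.assoc)
  have smQ: "summable (\<lambda>n. norm (a (Suc n)) ^ 2 * R ^ (2 * Suc n))"
  proof (rule summable_comparison_test'[OF sums_summable[OF geo2]])
    show "norm (norm (a (Suc n)) ^ 2 * R ^ (2 * Suc n)) \<le> L\<^sup>2 * R ^ (2 * Suc n)" for n
      using R cL[of "Suc n"] by (auto intro!: mult_right_mono power_mono)
  qed
  have Q: "Q \<le> lam * (1 - A\<^sup>2)\<^sup>2 / (4 * (1 + lam))"
  proof -
    have "Q \<le> L\<^sup>2 * (R\<^sup>2 / (1 - R\<^sup>2))"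
      unfolding Q_def sums_unique[OF geo2]
      by (intro suminf_le smQ sums_summable[OF geo2] mult_right_mono power_mono cL) (use R in auto)
    also have "R\<^sup>2 / (1 - R\<^sup>2) = 1 / (4 * lam * (1 + lam))"
    proof -
      \<comment> \<open>Since \<open>R * (1 + 2 * lam) = 1\<close>, this is
        \<open>(1 + 2 * lam)\<^sup>2 - 1 = 4 * lam * (1 + lam)\<close>.\<close>
      have "1 - R\<^sup>2 = R\<^sup>2 * (4 * lam * (1 + lam))"
      proof -
        have "R\<^sup>2 * (1 + 2 * lam)\<^sup>2 = 1" using lam by (simp add: R_def power_divide)
        moreover have "R\<^sup>2 * (4 * lam * (1 + lam)) = R\<^sup>2 * (1 + 2 * lam)\<^sup>2 - R\<^sup>2"
          by (simp add: power2_eq_square algebra_simps)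
        ultimately show ?thesis by simp
      qed
      then show ?thesis using R by simp
    qed
    also have "L\<^sup>2 * (1 / (4 * lam * (1 + lam))) = lam * (1 - A\<^sup>2)\<^sup>2 / (4 * (1 + lam))"
      unfolding L_def power_mult_distrib power2_eq_square[of lam] using lam by simp
    finally show ?thesis .
  qed
  have "A + S + ((1 + lam) / (2 * lam * (1 + A)) + (1 + lam) / (3 * lam)) * Q < 1"
  proof (cases "lam \<ge> 1 / 5")
    case True
    define d where "d n = norm (taylor_coeff (\<lambda>z. (f z - f 0) ^ 2) n)" for n
    have hh: "(\<lambda>z. f z - f 0) holomorphic_on ball 0 1" by (intro holomorphic_intros hf)
    have smd: "summable (\<lambda>n. d n * R ^ n)"
      unfolding d_def using R by (intro taylor_coeff_abs_summable[of _ 1] holomorphic_intros hf) auto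
    then have smd': "summable (\<lambda>n. d (Suc n) * R ^ Suc n)"
      by (subst summable_Suc_iff)
    have "Q \<le> (\<Sum>n. d n * R ^ n)"
      unfolding Q_def
    proof (rule suminf_le_const[OF smQ])
      fix N
      have "(\<Sum>n<N. norm (a (Suc n)) ^ 2 * R ^ (2 * Suc n))
        = (\<Sum>n<N. norm (taylor_coeff (\<lambda>z. f z - f 0) (Suc n)) ^ 2 * R ^ (2 * Suc n))"
        by (intro sum.cong refl) (simp add: a_def taylor_coeff_diff_const[OF hf zero_less_one])
      \<comment> \<open>The added term \<open>n = 0\<close> vanishes because
        \<open>f z - f 0\<close> is 0 at the origin; \<open>d 0 = 0\<close> for the same
        reason.\<close>
      also have "\<dots> = (\<Sum>n<Suc N. norm (taylor_coeff (\<lambda>z. f z - f 0) n) ^ 2 * R ^ (2 * n))"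
        by (subst sum.lessThan_Suc_shift) simp
      also have "\<dots> \<le> (\<Sum>n. d n * R ^ n)"
        unfolding d_def using R by (intro sum_norm_square_le_square_coeffs hh) auto
      finally show "(\<Sum>n<N. norm (a (Suc n)) ^ 2 * R ^ (2 * Suc n)) \<le> (\<Sum>n. d n * R ^ n)" .
    qed
    also have "\<dots> = (\<Sum>n. d (Suc n) * R ^ Suc n)"
      using suminf_split_head[OF smd] by (simp add: d_def)
    finally have Qd: "Q \<le> (\<Sum>n. d (Suc n) * R ^ Suc n)" .
    have "S \<le> (\<Sum>n. L * R ^ Suc n - d (Suc n) * R ^ Suc n / 2)"
      unfolding S_def
    proof (rule suminf_le[OF _ smS])
      show "norm (a (Suc n)) * R ^ Suc n \<le> L * R ^ Suc n - d (Suc n) * R ^ Suc n / 2" for n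
      proof -
        have "norm (a (Suc n)) \<le> L - d (Suc n) / 2"
          using schur_class_coeff_improved[OF bdd pos \<Omega> f, of "Suc n"]
          by (simp add: a_def L_def A_def d_def lam_def)
        then have "norm (a (Suc n)) * R ^ Suc n \<le> (L - d (Suc n) / 2) * R ^ Suc n"
          using R by (intro mult_right_mono) auto
        then show ?thesis by (simp only: left_diff_distrib times_divide_eq_left)
      qed
      show "summable (\<lambda>n. L * R ^ Suc n - d (Suc n) * R ^ Suc n / 2)"
        by (intro summable_diff summable_divide smd' sums_summable[OF sums_mult[OF geo]])
    qed
    also have "\<dots> = L * (R / (1 - R)) - (\<Sum>n. d (Suc n) * R ^ Suc n) / 2"
      by (rule sums_unique[symmetric], intro sums_diff sums_mult geo sums_divide summable_sums smd')
    also have "\<dots> \<le> (1 - A\<^sup>2) / 2 - Q / 2"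
      using Qd lam by (simp add: R1 L_def)
    finally show ?thesis by (rule bohr_inequality_large_lambda[OF A True _ Q])
  next
    case False
    define x where "x = 4 * lam * R"
    have x1: "x < 1" and num: "(\<Sum>n<7. lam * R ^ Suc n) + x ^ 8 / (1 - x) \<le> 1 / 2 - 1 / 100"
      using small_lambda_numeric[OF lam] False unfolding x_def R_def by auto
    have x0: "0 \<le> x" using lam R by (simp add: x_def)
    have "x ^ Suc (n + 7) = x ^ 8 * x ^ n" for n
    proof -
      have "Suc (n + 7) = 8 + n" by simp
      then show ?thesis by (simp only: power_add)
    qed
    then have geox: "(\<lambda>n. (1 - A\<^sup>2) * x ^ Suc (n + 7)) sums ((1 - A\<^sup>2) * (x ^ 8 / (1 - x)))"
      using sums_mult[OF geometric_sums[of x], of "(1 - A\<^sup>2) * x ^ 8"] x0 x1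
      by (simp only: mult.assoc abs_of_nonneg real_norm_def) simp
    \<comment> \<open>The coefficients of index 1 to 7 take the flat bound \<open>L\<close>; from
      index 8 on the decay of ratio \<open>x\<close> takes over.\<close>
    have "S = (\<Sum>n. norm (a (Suc (n + 7))) * R ^ Suc (n + 7)) + (\<Sum>n<7. norm (a (Suc n)) * R ^ Suc n)"
      unfolding S_def by (rule suminf_split_initial_segment[OF smS])
    also have "\<dots> \<le> (1 - A\<^sup>2) * (x ^ 8 / (1 - x)) + (\<Sum>n<7. L * R ^ Suc n)"
    proof (rule add_mono)
      show "(\<Sum>n<7. norm (a (Suc n)) * R ^ Suc n) \<le> (\<Sum>n<7. L * R ^ Suc n)"
        by (intro sum_mono mult_right_mono cL) (use R in auto)
      have "norm (a (Suc m)) * R ^ Suc m \<le> (1 - A\<^sup>2) * x ^ Suc m" for m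
      proof -
        have "norm (a (Suc m)) * R ^ Suc m \<le> ((1 - A\<^sup>2) * (4 * lam) ^ Suc m) * R ^ Suc m"
          using schur_class_coeff_decay[OF op sc bdd pos \<Omega> f, of "Suc m"] R
          by (intro mult_right_mono) (auto simp: a_def A_def lam_def)
        then show ?thesis by (simp only: x_def power_mult_distrib mult.assoc)
      qed
      then show "(\<Sum>n. norm (a (Suc (n + 7))) * R ^ Suc (n + 7)) \<le> (1 - A\<^sup>2) * (x ^ 8 / (1 - x))"
        unfolding sums_unique[OF geox]
        by (intro suminf_le sums_summable[OF geox] summable_ignore_initial_segment[OF smS])
    qed
    also have "\<dots> = (1 - A\<^sup>2) * ((\<Sum>n<7. lam * R ^ Suc n) + x ^ 8 / (1 - x))"
      by (simp add: L_def sum_distrib_left algebra_simps)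
    also have "\<dots> \<le> (1 - A\<^sup>2) * (1 / 2 - 1 / 100)"
      using A2 by (intro mult_left_mono num) auto
    finally show ?thesis by (rule bohr_inequality_small_lambda[OF A lam _ Q])
  qed
  moreover have "2 / 3 * ((1 + lam) * R / (1 - R)) = (1 + lam) / (3 * lam)"
  proof -
    have "2 / 3 * ((1 + lam) * R / (1 - R)) = 2 / 3 * ((1 + lam) * (R / (1 - R)))" by simp
    also have "\<dots> = (1 + lam) / (3 * lam)" unfolding R1 using lam by (simp add: field_simps)
    finally show ?thesis .
  qed
  ultimately show ?thesis
    unfolding split Q_def[symmetric] by (simp add: a_def A_def)
qed

theorem theorem2p5:
  fixes \<Omega> :: "complex set" and f :: "complex \<Rightarrow> complex"
  defines "lam \<equiv> bohr_lambda \<Omega>"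
  defines "a \<equiv> taylor_coeff f"
  assumes "open \<Omega>" and "connected \<Omega>" and "simply_connected \<Omega>"
    and "ball 0 1 \<subseteq> \<Omega>"
    and "bdd_above (bohr_lambda_set \<Omega>)" and "lam > 0"
    and "f \<in> schur_class \<Omega>"
  shows "(\<forall>r. 0 < r \<and> r \<le> 1 / (1 + 2 * lam) \<longrightarrow>
           (\<Sum>n. norm (a n) * r ^ n)
           + ((1 + lam) / (2 * lam * (1 + norm (a 0))) + 2 / 3 * ((1 + lam) * r / (1 - r)))
             * (\<Sum>n. norm (a (Suc n)) ^ 2 * r ^ (2 * Suc n)) \<le> 1) \<and>
         ((\<Sum>n. norm (a n) * (1 / (1 + 2 * lam)) ^ n)
           + ((1 + lam) / (2 * lam * (1 + norm (a 0)))
              + 2 / 3 * ((1 + lam) * (1 / (1 + 2 * lam)) / (1 - 1 / (1 + 2 * lam))))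
             * (\<Sum>n. norm (a (Suc n)) ^ 2 * (1 / (1 + 2 * lam)) ^ (2 * Suc n)) = 1
         \<longrightarrow> (\<exists>c. norm c = 1 \<and> (\<forall>z\<in>\<Omega>. f z = c)))"
proof -
  define R where "R = 1 / (1 + 2 * lam)"
  define G where "G r = (\<Sum>n. norm (a n) * r ^ n)
           + ((1 + lam) / (2 * lam * (1 + norm (a 0))) + 2 / 3 * ((1 + lam) * r / (1 - r)))
             * (\<Sum>n. norm (a (Suc n)) ^ 2 * r ^ (2 * Suc n))" for r :: real
  note lam = \<open>lam > 0\<close>
  have R: "0 < R" "R < 1" using lam by (auto simp: R_def)
  have G_R: "G R < 1"
    using bohr_inequality_at_radius[OF assms(3,5,7) assms(8)[unfolded lam_def] assms(6,9)]
    by (simp only: G_def R_def lam_def a_def)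
  have hf: "f holomorphic_on ball 0 1"
    using assms(6,9) by (auto simp: schur_class_def intro: holomorphic_on_subset)
  have G_mono: "G r \<le> G R" if r: "0 < r" "r \<le> R" for r
  proof -
    have sm: "summable (\<lambda>n. norm (a n) * s ^ n)" if "0 < s" "s < 1" for s
      unfolding a_def using that by (intro taylor_coeff_abs_summable[OF hf]) auto
    have sm2: "summable (\<lambda>n. norm (a (Suc n)) ^ 2 * s ^ (2 * Suc n))" if s: "0 < s" "s < 1" for s
    proof (rule summable_comparison_test')
      have "s\<^sup>2 < 1" using s by (simp add: abs_square_less_1)
      then have "summable (\<lambda>n. s\<^sup>2 * (s\<^sup>2) ^ n)" by (intro summable_mult summable_geometric) simp
      then show "summable (\<lambda>n. s ^ (2 * Suc n))" by (simp add: power_mult[symmetric] power_add)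
      have "norm (a m) \<le> 1" for m
        using taylor_coeff_bounded[OF hf, of 1 m] assms(6,9)
        by (force simp: a_def schur_class_def subset_iff intro: less_imp_le)
      then show "norm (norm (a (Suc n)) ^ 2 * s ^ (2 * Suc n)) \<le> s ^ (2 * Suc n)" for n
        using s by (auto intro!: mult_left_le_one_le power_le_one)
    qed
    show ?thesis
      unfolding G_def
    proof (intro add_mono mult_mono)
      show "(\<Sum>n. norm (a n) * r ^ n) \<le> (\<Sum>n. norm (a n) * R ^ n)"
        using r R by (intro suminf_le mult_left_mono power_mono sm) auto
      show "(\<Sum>n. norm (a (Suc n)) ^ 2 * r ^ (2 * Suc n)) \<le> (\<Sum>n. norm (a (Suc n)) ^ 2 * R ^ (2 * Suc n))"
        using r R by (intro suminf_le mult_left_mono power_mono sm2) auto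
      show "(1 + lam) * r / (1 - r) \<le> (1 + lam) * R / (1 - R)"
        using r R lam by (intro frac_le mult_left_mono) auto
      show "0 \<le> (\<Sum>n. norm (a (Suc n)) ^ 2 * r ^ (2 * Suc n))"
        using r R by (intro suminf_nonneg sm2) auto
    qed (use r R lam in auto)
  qed
  have "\<forall>r. 0 < r \<and> r \<le> R \<longrightarrow> G r \<le> 1"
    using G_mono G_R by (meson less_imp_le order_trans)
  \<comment> \<open>Strictness at the critical radius refutes the premise of the equality
    clause.\<close>
  moreover have "G R \<noteq> 1" using G_R by simp
  ultimately show ?thesis
    unfolding G_def R_def by blast
qed

end
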